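(* Let $\mathbf{C}$ be any category (no limits or colimits are assumed to exist in $\mathbf{C}$). Then the category of internal groupoids in $\mathbf{C}$ is equivalent to the full subcategory, of the category of involutive-2-links in $\mathbf{C}$, whose objects are the involutive-2-links that are both unital and associative.
   Context: Composition of morphisms is written by juxtaposition: $gf$ means first $f$, then $g$. When a commutative square is a pullback of $d$ and $c$ with projections $\pi_1,\pi_2$ (so $d\pi_1=c\pi_2$), and $u,v$ are morphisms with the same domain such that $du=cv$, then $\langle u,v\rangle$ denotes the unique morphism with $\pi_1\langle u,v\rangle=u$ and $\pi_2\langle u,v\rangle=v$. **Involutive-2-links.** An involutive-2-link in $\mathbf{C}$ is a triple $(\theta,\varphi,m\colon A\to B)$ consisting of a morphism $m\colon A\to B$ and two endomorphisms $\theta,\varphi\colon A\to A$ such that $\theta^2=\varphi^2=1_A$ and $\theta\varphi\theta=\varphi\theta\varphi$. A morphism of involutive-2-links from $(\theta,\varphi,m\colon A\to B)$ to $(\theta',\varphi',m'\colon A'\to B')$ is a pair of morphisms $(f\colon A\to A',\ g\colon B\to B')$ such that $f\theta=\theta'f$, $f\varphi=\varphi'f$ and $m'f=gm$. **Bi-exact pairs.** A pair of parallel morphisms $\pi_1,\pi_2\colon C_2\to C_1$ is bi-exact if both of the following hold: - there are an object $C_0$ and morphisms $d,c\colon C_1\to C_0$ with $d\pi_1=c\pi_2$ such that this commutative square (with span $\pi_1,\pi_2$ out of $C_2$ and cospan $d,c$ into $C_0$) is both a pullback and a pushout in $\mathbf{C}$; - there are an object $C_3$ and morphisms $p_1,p_2\colon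 C_3\to C_2$ with $\pi_2p_1=\pi_1p_2$ such that this commutative square (with span $p_1,p_2$ out of $C_3$ and cospan $\pi_2,\pi_1$ into $C_1$) is both a pullback and a pushout in $\mathbf{C}$. **Unital.** An involutive-2-link $(\theta,\varphi,m\colon C_2\to C_1)$ is unital when the pairs of morphisms $(m,m\theta)$ and $(m,m\varphi)$ are each jointly monomorphic and there exist morphisms $e_1,e_2\colon C_1\to C_2$ such that $$me_1=1_{C_1}=me_2,$$ $$\theta e_2=e_2,\qquad \varphi e_1=e_1,$$ $$m\theta\varphi e_2=m\varphi\theta e_1,$$ $$m\theta e_1m\varphi=m\varphi e_2m\theta,$$ $$m\theta e_1m=m\theta e_1m\theta,$$ $$m\varphi e_2m=m\varphi e_2m\varphi.$$ **Associative.** An involutive-2-link $(\theta,\varphi,m\colon C_2\to C_1)$ is associative when, putting $\pi_1=m\varphi$ and $\pi_2=m\theta$, the pair $(\pi_1,\pi_2)$ is bi-exact and, with $C_3,p_1,p_2$ as in the definition of bi-exactness, the induced morphisms $m_1,m_2\colon C_3\to C_2$ determined by $$\pi_1m_1=mp_1,\quad \pi_2m_1=\pi_2p_2,\qquad \pi_1m_2=\pi_1p_1,\quad \pi_2m_2=mp_2$$ (there is at most one such $m_1$ and one such $m_2$, since $C_2$ is a pullback with projections $\pi_1,\pi_2$; their existence is part of the condition) satisfy $mm_1=mm_2$. **Internal groupoids.** An internal groupoid in $\mathbf{C}$ consists of objects $C_0,C_1,C_2$ and morphisms $\pi_1,\pi_2,m\colon C_2\to C_1$, $d,c\colon C_1\to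 C_0$, $e\colon C_0\to C_1$, $i\colon C_1\to C_1$ such that $$de=1_{C_0}=ce,\qquad dm=d\pi_2,\quad cm=c\pi_1,\quad d\pi_1=c\pi_2,$$ $$di=c,\quad ci=d,\quad i^2=1_{C_1},\quad ie=e,$$ and such that: - (a) the square $d\pi_1=c\pi_2$ is a pullback square; - (b) $m\langle 1_{C_1},ed\rangle=1_{C_1}=m\langle ec,1_{C_1}\rangle$; - (c) $m\langle 1_{C_1},i\rangle=ec$ and $m\langle i,1_{C_1}\rangle=ed$; - (d) the cospan $d\pi_2\colon C_2\to C_0\leftarrow C_1\colon c$ can be completed into a pullback square, with projections $q_1\colon Q\to C_2$ and $q_2\colon Q\to C_1$ (so $d\pi_2q_1=cq_2$); - (e) $m(1\times m)=m(m\times 1)$, where $(1\times m),(m\times 1)\colon Q\to C_2$ are the morphisms uniquely determined by $\pi_1(m\times 1)=mq_1$, $\pi_2(m\times 1)=q_2$, $\pi_1(1\times m)=\pi_1q_1$, $\pi_2(1\times m)=m\langle\pi_2q_1,q_2\rangle$. A morphism of internal groupoids from $(C_0,C_1,C_2,\pi_1,\pi_2,m,d,c,e,i)$ to $(C'_0,C'_1,C'_2,\pi'_1,\pi'_2,m',d',c',e',i')$ is a triple of morphisms $f_k\colon C_k\to C'_k$ ($k=0,1,2$) commuting with all the structure: $\pi'_jf_2=f_1\pi_j$ ($j=1,2$), $m'f_2=f_1m$, $d'f_1=f_0d$, $c'f_1=f_0c$, $e'f_0=f_1e$, $i'f_1=f_1i$. *)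

theory Defs
  imports Main
begin

text \<open>
  Categories have explicit carriers of objects and arrows inside arbitrary types. As usual
  for carrier-based structures, the operations are only meaningful on the carriers, and
  \<open>Comp\<close> only on composable pairs; \<open>g \<cdot> f\<close> means first \<open>f\<close>, then \<open>g\<close>.
\<close>

record ('o, 'a) cat =
  Obj :: "'o set"
  Arr :: "'a set"
  Dom :: "'a \<Rightarrow> 'o"
  Cod :: "'a \<Rightarrow> 'o"
  Ident :: "'o \<Rightarrow> 'a"  ("\<one>\<index>")
  Comp :: "'a \<Rightarrow> 'a \<Rightarrow> 'a"  (infixl "\<cdot>\<index>" 70)

definition Hom :: "('o, 'a) cat \<Rightarrow> 'o \<Rightarrow> 'o \<Rightarrow> 'a set" where
  "Hom C x y = {f \<in> Arr C. Dom C f = x \<and> Cod C f = y}"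

locale category =
  fixes C :: "('o, 'a) cat" (structure)
  assumes dom_obj: "f \<in> Arr C \<Longrightarrow> Dom C f \<in> Obj C"
    and cod_obj: "f \<in> Arr C \<Longrightarrow> Cod C f \<in> Obj C"
    and ident_hom: "x \<in> Obj C \<Longrightarrow> \<one> x \<in> Hom C x x"
    and comp_hom: "f \<in> Hom C x y \<Longrightarrow> g \<in> Hom C y z \<Longrightarrow> g \<cdot> f \<in> Hom C x z"
    and comp_ident: "f \<in> Hom C x y \<Longrightarrow> f \<cdot> \<one> x = f"
    and ident_comp: "f \<in> Hom C x y \<Longrightarrow> \<one> y \<cdot> f = f"
    and comp_assoc: "f \<in> Hom C w x \<Longrightarrow> g \<in> Hom C x y \<Longrightarrow> h \<in> Hom C y z \<Longrightarrow>
      (h \<cdot> g) \<cdot> f = h \<cdot> (g \<cdot> f)"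

definition full_subcategory :: "('o, 'a) cat \<Rightarrow> 'o set \<Rightarrow> ('o, 'a) cat" where
  "full_subcategory C S =
    C\<lparr>Obj := Obj C \<inter> S, Arr := {f \<in> Arr C. Dom C f \<in> S \<and> Cod C f \<in> S}\<rparr>"

definition iso_arrow :: "('o, 'a) cat \<Rightarrow> 'a \<Rightarrow> bool" where
  "iso_arrow C f \<longleftrightarrow> f \<in> Arr C \<and>
    (\<exists>g \<in> Hom C (Cod C f) (Dom C f). g \<cdot> f = \<one> (Dom C f) \<and> f \<cdot> g = \<one> (Cod C f))"
  for C (structure)

locale category_functor = A: category A + B: category B
  for A :: "('o, 'a) cat" and B :: "('p, 'b) cat" +
  fixes Fo :: "'o \<Rightarrow> 'p" and Fa :: "'a \<Rightarrow> 'b"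
  assumes map_obj: "x \<in> Obj A \<Longrightarrow> Fo x \<in> Obj B"
    and map_hom: "f \<in> Hom A x y \<Longrightarrow> Fa f \<in> Hom B (Fo x) (Fo y)"
    and map_ident: "x \<in> Obj A \<Longrightarrow> Fa (\<one>\<^bsub>A\<^esub> x) = \<one>\<^bsub>B\<^esub> (Fo x)"
    and map_comp: "f \<in> Hom A x y \<Longrightarrow> g \<in> Hom A y z \<Longrightarrow> Fa (g \<cdot>\<^bsub>A\<^esub> f) = Fa g \<cdot>\<^bsub>B\<^esub> Fa f"

locale natural_isomorphism =
  F: category_functor A B Fo Fa + G: category_functor A B Go Ga
  for A :: "('o, 'a) cat" and B :: "('p, 'b) cat" and Fo Fa Go Ga +
  fixes \<eta> :: "'o \<Rightarrow> 'b"
  assumes component_hom: "x \<in> Obj A \<Longrightarrow> \<eta> x \<in> Hom B (Fo x) (Go x)"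
    and component_iso: "x \<in> Obj A \<Longrightarrow> iso_arrow B (\<eta> x)"
    and naturality: "f \<in> Hom A x y \<Longrightarrow> \<eta> y \<cdot>\<^bsub>B\<^esub> Fa f = Ga f \<cdot>\<^bsub>B\<^esub> \<eta> x"

definition equivalent_categories :: "('o, 'a) cat \<Rightarrow> ('p, 'b) cat \<Rightarrow> bool" where
  "equivalent_categories A B \<longleftrightarrow> (\<exists>Fo Fa Go Ga \<eta> \<epsilon>.
    category_functor A B Fo Fa \<and> category_functor B A Go Ga \<and>
    natural_isomorphism A A id id (Go \<circ> Fo) (Ga \<circ> Fa) \<eta> \<and>
    natural_isomorphism B B (Fo \<circ> Go) (Fa \<circ> Ga) id id \<epsilon>)"

text \<open>
  A category from a set of objects, hom-sets (not necessarily disjoint), identities and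
  composition; arrows are tagged with their domain and codomain.
\<close>

definition tagged_category ::
  "'x set \<Rightarrow> ('x \<Rightarrow> 'x \<Rightarrow> 'f set) \<Rightarrow> ('x \<Rightarrow> 'f) \<Rightarrow> ('f \<Rightarrow> 'f \<Rightarrow> 'f) \<Rightarrow> ('x, 'x \<times> 'f \<times> 'x) cat" where
  "tagged_category X H ident cmp =
    \<lparr>Obj = X,
     Arr = {(x, f, y). x \<in> X \<and> y \<in> X \<and> f \<in> H x y},
     Dom = (\<lambda>(x, f, y). x),
     Cod = (\<lambda>(x, f, y). y),
     Ident = (\<lambda>x. (x, ident x, x)),
     Comp = (\<lambda>(y', g, z) (x, f, y). (x, cmp g f, z))\<rparr>"

definition commutative_square :: "('o, 'a) cat \<Rightarrow> 'a \<Rightarrow> 'a \<Rightarrow> 'a \<Rightarrow> 'a \<Rightarrow> bool" where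
  "commutative_square C p1 p2 d c \<longleftrightarrow>
    {p1, p2, d, c} \<subseteq> Arr C \<and> Dom C p1 = Dom C p2 \<and>
    Cod C p1 = Dom C d \<and> Cod C p2 = Dom C c \<and> Cod C d = Cod C c \<and>
    d \<cdot> p1 = c \<cdot> p2"
  for C (structure)

definition pullback_square :: "('o, 'a) cat \<Rightarrow> 'a \<Rightarrow> 'a \<Rightarrow> 'a \<Rightarrow> 'a \<Rightarrow> bool" where
  "pullback_square C p1 p2 d c \<longleftrightarrow> commutative_square C p1 p2 d c \<and>
    (\<forall>X. \<forall>u \<in> Hom C X (Dom C d). \<forall>v \<in> Hom C X (Dom C c). d \<cdot> u = c \<cdot> v \<longrightarrow>
      (\<exists>!h. h \<in> Hom C X (Dom C p1) \<and> p1 \<cdot> h = u \<and> p2 \<cdot> h = v))"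
  for C (structure)

definition pushout_square :: "('o, 'a) cat \<Rightarrow> 'a \<Rightarrow> 'a \<Rightarrow> 'a \<Rightarrow> 'a \<Rightarrow> bool" where
  "pushout_square C p1 p2 d c \<longleftrightarrow> commutative_square C p1 p2 d c \<and>
    (\<forall>X. \<forall>u \<in> Hom C (Cod C p1) X. \<forall>v \<in> Hom C (Cod C p2) X. u \<cdot> p1 = v \<cdot> p2 \<longrightarrow>
      (\<exists>!h. h \<in> Hom C (Cod C d) X \<and> h \<cdot> d = u \<and> h \<cdot> c = v))"
  for C (structure)

text \<open>\<open>pairing C p1 p2 u v\<close> is only meaningful when \<open>p1, p2\<close> are the projections of a pullback
  through which \<open>u, v\<close> factor.\<close>

definition pairing :: "('o, 'a) cat \<Rightarrow> 'a \<Rightarrow> 'a \<Rightarrow> 'a \<Rightarrow> 'a \<Rightarrow> 'a" where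
  "pairing C p1 p2 u v =
    (THE h. h \<in> Hom C (Dom C u) (Dom C p1) \<and> p1 \<cdot> h = u \<and> p2 \<cdot> h = v)"
  for C (structure)

definition jointly_monic :: "('o, 'a) cat \<Rightarrow> 'a \<Rightarrow> 'a \<Rightarrow> bool" where
  "jointly_monic C u v \<longleftrightarrow> u \<in> Arr C \<and> v \<in> Arr C \<and> Dom C u = Dom C v \<and>
    (\<forall>X. \<forall>h \<in> Hom C X (Dom C u). \<forall>k \<in> Hom C X (Dom C u).
      u \<cdot> h = u \<cdot> k \<and> v \<cdot> h = v \<cdot> k \<longrightarrow> h = k)"
  for C (structure)

type_synonym 'a link = "'a \<times> 'a \<times> 'a"

text \<open>In a link \<open>(\<theta>, \<phi>, m : A \<rightarrow> B)\<close>, the objects \<open>A\<close> and \<open>B\<close> are the domain and codomain of \<open>m\<close>.\<close>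

definition involutive_2_links :: "('o, 'a) cat \<Rightarrow> 'a link set" where
  "involutive_2_links C = {(\<theta>, \<phi>, m). \<exists>A B.
    m \<in> Hom C A B \<and> \<theta> \<in> Hom C A A \<and> \<phi> \<in> Hom C A A \<and>
    \<theta> \<cdot> \<theta> = \<one> A \<and> \<phi> \<cdot> \<phi> = \<one> A \<and> \<theta> \<cdot> \<phi> \<cdot> \<theta> = \<phi> \<cdot> \<theta> \<cdot> \<phi>}"
  for C (structure)

fun link_homs :: "('o, 'a) cat \<Rightarrow> 'a link \<Rightarrow> 'a link \<Rightarrow> ('a \<times> 'a) set" where
  "link_homs C (\<theta>, \<phi>, m) (\<theta>', \<phi>', m') = {(f, g).
    f \<in> Hom C (Dom C m) (Dom C m') \<and> g \<in> Hom C (Cod C m) (Cod C m') \<and>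
    f \<cdot>\<^bsub>C\<^esub> \<theta> = \<theta>' \<cdot>\<^bsub>C\<^esub> f \<and> f \<cdot>\<^bsub>C\<^esub> \<phi> = \<phi>' \<cdot>\<^bsub>C\<^esub> f \<and> m' \<cdot>\<^bsub>C\<^esub> f = g \<cdot>\<^bsub>C\<^esub> m}"

definition link_category :: "('o, 'a) cat \<Rightarrow> ('a link, 'a link \<times> ('a \<times> 'a) \<times> 'a link) cat" where
  "link_category C = tagged_category (involutive_2_links C) (link_homs C)
    (\<lambda>(\<theta>, \<phi>, m). (\<one> (Dom C m), \<one> (Cod C m)))
    (\<lambda>(f', g') (f, g). (f' \<cdot> f, g' \<cdot> g))"
  for C (structure)

definition bi_exact :: "('o, 'a) cat \<Rightarrow> 'a \<Rightarrow> 'a \<Rightarrow> bool" where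
  "bi_exact C \<pi>1 \<pi>2 \<longleftrightarrow>
    (\<exists>C1 C2. \<pi>1 \<in> Hom C C2 C1 \<and> \<pi>2 \<in> Hom C C2 C1) \<and>
    (\<exists>d c. pullback_square C \<pi>1 \<pi>2 d c \<and> pushout_square C \<pi>1 \<pi>2 d c) \<and>
    (\<exists>p1 p2. pullback_square C p1 p2 \<pi>2 \<pi>1 \<and> pushout_square C p1 p2 \<pi>2 \<pi>1)"

definition unital :: "('o, 'a) cat \<Rightarrow> 'a link \<Rightarrow> bool" where
  "unital C = (\<lambda>(\<theta>, \<phi>, m).
    jointly_monic C m (m \<cdot> \<theta>) \<and> jointly_monic C m (m \<cdot> \<phi>) \<and>
    (\<exists>e1 \<in> Hom C (Cod C m) (Dom C m). \<exists>e2 \<in> Hom C (Cod C m) (Dom C m).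
      m \<cdot> e1 = \<one> (Cod C m) \<and> m \<cdot> e2 = \<one> (Cod C m) \<and>
      \<theta> \<cdot> e2 = e2 \<and> \<phi> \<cdot> e1 = e1 \<and>
      m \<cdot> \<theta> \<cdot> \<phi> \<cdot> e2 = m \<cdot> \<phi> \<cdot> \<theta> \<cdot> e1 \<and>
      m \<cdot> \<theta> \<cdot> e1 \<cdot> m \<cdot> \<phi> = m \<cdot> \<phi> \<cdot> e2 \<cdot> m \<cdot> \<theta> \<and>
      m \<cdot> \<theta> \<cdot> e1 \<cdot> m = m \<cdot> \<theta> \<cdot> e1 \<cdot> m \<cdot> \<theta> \<and>
      m \<cdot> \<phi> \<cdot> e2 \<cdot> m = m \<cdot> \<phi> \<cdot> e2 \<cdot> m \<cdot> \<phi>))"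
  for C (structure)

text \<open>
  The square \<open>p1, p2\<close> below is unique up to isomorphism, so it does not matter which one
  is used to form \<open>m1\<close> and \<open>m2\<close>.
\<close>

definition associative :: "('o, 'a) cat \<Rightarrow> 'a link \<Rightarrow> bool" where
  "associative C = (\<lambda>(\<theta>, \<phi>, m). let \<pi>1 = m \<cdot> \<phi>; \<pi>2 = m \<cdot> \<theta> in
    bi_exact C \<pi>1 \<pi>2 \<and>
    (\<exists>p1 p2. pullback_square C p1 p2 \<pi>2 \<pi>1 \<and> pushout_square C p1 p2 \<pi>2 \<pi>1 \<and>
      (\<exists>m1 \<in> Hom C (Dom C p1) (Dom C m). \<exists>m2 \<in> Hom C (Dom C p1) (Dom C m).
        \<pi>1 \<cdot> m1 = m \<cdot> p1 \<and> \<pi>2 \<cdot> m1 = \<pi>2 \<cdot> p2 \<and>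
        \<pi>1 \<cdot> m2 = \<pi>1 \<cdot> p1 \<and> \<pi>2 \<cdot> m2 = m \<cdot> p2 \<and>
        m \<cdot> m1 = m \<cdot> m2)))"
  for C (structure)

type_synonym ('o, 'a) igpd =
  "'o \<times> 'o \<times> 'o \<times> 'a \<times> 'a \<times> 'a \<times> 'a \<times> 'a \<times> 'a \<times> 'a"

text \<open>
  In \<open>associativity\<close>, the two sides are \<open>m \<cdot> (1 \<times> m)\<close> and \<open>m \<cdot> (m \<times> 1)\<close> on the object of composable
  triples, with the morphisms \<open>1 \<times> m\<close> and \<open>m \<times> 1\<close> given by their components.
\<close>

locale internal_groupoid = category C
  for C :: "('o, 'a) cat" (structure) +
  fixes C0 C1 C2 :: 'o
    and \<pi>1 \<pi>2 m d c e i :: 'a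
  assumes objects: "C0 \<in> Obj C" "C1 \<in> Obj C" "C2 \<in> Obj C"
    and arrows: "\<pi>1 \<in> Hom C C2 C1" "\<pi>2 \<in> Hom C C2 C1" "m \<in> Hom C C2 C1"
      "d \<in> Hom C C1 C0" "c \<in> Hom C C1 C0" "e \<in> Hom C C0 C1" "i \<in> Hom C C1 C1"
    and reflexive: "d \<cdot> e = \<one> C0" "c \<cdot> e = \<one> C0"
    and boundary: "d \<cdot> m = d \<cdot> \<pi>2" "c \<cdot> m = c \<cdot> \<pi>1" "d \<cdot> \<pi>1 = c \<cdot> \<pi>2"
    and involution: "d \<cdot> i = c" "c \<cdot> i = d" "i \<cdot> i = \<one> C1" "i \<cdot> e = e"
    and composable: "pullback_square C \<pi>1 \<pi>2 d c"
    and units: "m \<cdot> pairing C \<pi>1 \<pi>2 (\<one> C1) (e \<cdot> d) = \<one> C1"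
      "m \<cdot> pairing C \<pi>1 \<pi>2 (e \<cdot> c) (\<one> C1) = \<one> C1"
    and inverses: "m \<cdot> pairing C \<pi>1 \<pi>2 (\<one> C1) i = e \<cdot> c"
      "m \<cdot> pairing C \<pi>1 \<pi>2 i (\<one> C1) = e \<cdot> d"
    and associativity: "\<exists>q1 q2. pullback_square C q1 q2 (d \<cdot> \<pi>2) c \<and>
      m \<cdot> pairing C \<pi>1 \<pi>2 (\<pi>1 \<cdot> q1) (m \<cdot> pairing C \<pi>1 \<pi>2 (\<pi>2 \<cdot> q1) q2) =
      m \<cdot> pairing C \<pi>1 \<pi>2 (m \<cdot> q1) q2"

definition internal_groupoids :: "('o, 'a) cat \<Rightarrow> ('o, 'a) igpd set" where
  "internal_groupoids C = {(C0, C1, C2, \<pi>1, \<pi>2, m, d, c, e, i).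
    internal_groupoid C C0 C1 C2 \<pi>1 \<pi>2 m d c e i}"

fun groupoid_homs ::
  "('o, 'a) cat \<Rightarrow> ('o, 'a) igpd \<Rightarrow> ('o, 'a) igpd \<Rightarrow> ('a \<times> 'a \<times> 'a) set" where
  "groupoid_homs C (C0, C1, C2, \<pi>1, \<pi>2, m, d, c, e, i)
      (C0', C1', C2', \<pi>1', \<pi>2', m', d', c', e', i') = {(f0, f1, f2).
    f0 \<in> Hom C C0 C0' \<and> f1 \<in> Hom C C1 C1' \<and> f2 \<in> Hom C C2 C2' \<and>
    \<pi>1' \<cdot>\<^bsub>C\<^esub> f2 = f1 \<cdot>\<^bsub>C\<^esub> \<pi>1 \<and> \<pi>2' \<cdot>\<^bsub>C\<^esub> f2 = f1 \<cdot>\<^bsub>C\<^esub> \<pi>2 \<and> m' \<cdot>\<^bsub>C\<^esub> f2 = f1 \<cdot>\<^bsub>C\<^esub> m \<and>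
    d' \<cdot>\<^bsub>C\<^esub> f1 = f0 \<cdot>\<^bsub>C\<^esub> d \<and> c' \<cdot>\<^bsub>C\<^esub> f1 = f0 \<cdot>\<^bsub>C\<^esub> c \<and>
    e' \<cdot>\<^bsub>C\<^esub> f0 = f1 \<cdot>\<^bsub>C\<^esub> e \<and> i' \<cdot>\<^bsub>C\<^esub> f1 = f1 \<cdot>\<^bsub>C\<^esub> i}"

definition groupoid_category ::
  "('o, 'a) cat \<Rightarrow> (('o, 'a) igpd, ('o, 'a) igpd \<times> ('a \<times> 'a \<times> 'a) \<times> ('o, 'a) igpd) cat" where
  "groupoid_category C = tagged_category (internal_groupoids C) (groupoid_homs C)
    (\<lambda>(C0, C1, C2, _). (\<one> C0, \<one> C1, \<one> C2))
    (\<lambda>(g0, g1, g2) (f0, f1, f2). (g0 \<cdot> f0, g1 \<cdot> f1, g2 \<cdot> f2))"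
  for C (structure)

end

theory Submission
  imports Defs
begin

text \<open>
  To a groupoid corresponds the link given on generalized elements by
  \<open>\<theta> (x, y) = (x\<inverse>, x y)\<close> and \<open>\<phi> (x, y) = (x y, y\<inverse>)\<close>; so \<open>\<pi>1 = m \<phi>\<close> and \<open>\<pi>2 = m \<theta>\<close>,
  and the squares required to be pushouts are so because they split. Conversely, in a unital
  associative link, \<open>e\<close> is induced by the pushout \<open>C0\<close>, the inverse is \<open>m \<theta> \<phi> e2\<close>, and
  cancellation in the resulting groupoid forces \<open>\<theta>\<close> and \<open>\<phi>\<close> to be given by the formulas above.
  So the functor is surjective on objects, not only up to isomorphism. It is fully faithful
  because a morphism of links preserves \<open>\<pi>1\<close>, \<open>\<pi>2\<close> and \<open>m\<close>, hence by cancellation identities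
  and inverses, and because \<open>f0 = d' f1 e\<close>.
\<close>

section \<open>Categories\<close>

text \<open>A composable pair (x, y) is a commutative triangle with vertices c x, d x = c y and d y.
  Here \<open>\<theta>\<close> swaps the first two vertices and \<open>\<phi>\<close> the last two,
  so the relations of a link are those of the symmetric group on three letters, and the faces x, y,
  x y are recovered from the single \<open>m\<close> by this action. The obstacle is that objects
  have no elements and the two definitions use different squares of composable triples: a groupoid
  asks for a pullback of \<open>d \<cdot> \<pi>2\<close> and \<open>c\<close>, a link for one of
  \<open>\<pi>2\<close> and \<open>\<pi>1\<close>. The algebra is therefore done with generalized
  elements, where associativity mentions neither square, and the squares are translated by reading a
  triple (x, y, z) as the overlapping pairs (x, y) and (y, z). Groupoids and links then share the
  same cancellation laws.\<close>

lemma tagged_category_category: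
  assumes ident: "\<And>x. x \<in> X \<Longrightarrow> ident x \<in> H x x"
    and comp: "\<And>x y z f g. \<lbrakk>x \<in> X; y \<in> X; z \<in> X; f \<in> H x y; g \<in> H y z\<rbrakk> \<Longrightarrow> cmp g f \<in> H x z"
    and comp_ident: "\<And>x y f. \<lbrakk>x \<in> X; y \<in> X; f \<in> H x y\<rbrakk> \<Longrightarrow> cmp f (ident x) = f"
    and ident_comp: "\<And>x y f. \<lbrakk>x \<in> X; y \<in> X; f \<in> H x y\<rbrakk> \<Longrightarrow> cmp (ident y) f = f"
    and assoc: "\<And>w x y z f g h. \<lbrakk>w \<in> X; x \<in> X; y \<in> X; z \<in> X; f \<in> H w x; g \<in> H x y; h \<in> H y z\<rbrakk>
      \<Longrightarrow> cmp (cmp h g) f = cmp h (cmp g f)"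
  shows "category (tagged_category X H ident cmp)"
  unfolding tagged_category_def
  by unfold_locales (auto simp: Hom_def ident comp comp_ident ident_comp assoc)

lemma Hom_tagged_category:
  "Hom (tagged_category X H ident cmp) x y = {(x, f, y) | f. x \<in> X \<and> y \<in> X \<and> f \<in> H x y}"
  by (auto simp: Hom_def tagged_category_def)

lemma Hom_full_subcategory:
  "Hom (full_subcategory C S) x y = {f \<in> Hom C x y. x \<in> S \<and> y \<in> S}"
  by (auto simp: Hom_def full_subcategory_def)

lemma full_subcategory_simps [simp]:
  "Obj (full_subcategory C S) = Obj C \<inter> S"
  "Ident (full_subcategory C S) = Ident C"
  "Comp (full_subcategory C S) = Comp C"
  by (simp_all add: full_subcategory_def)

lemma category_full_subcategory:
  assumes "category C"
  shows "category (full_subcategory C S)"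
proof -
  interpret category C by fact
  show ?thesis
  proof
    fix f assume "f \<in> Arr (full_subcategory C S)"
    then show "Dom (full_subcategory C S) f \<in> Obj (full_subcategory C S)"
      "Cod (full_subcategory C S) f \<in> Obj (full_subcategory C S)"
      by (auto simp: full_subcategory_def dom_obj cod_obj)
  qed (auto simp: Hom_full_subcategory ident_hom comp_hom comp_ident ident_comp comp_assoc)
qed

section \<open>Fully faithful functors that are surjective on objects\<close>

lemma category_functor_comp:
  assumes "category_functor A B Fo Fa" "category_functor B D Go Ga"
  shows "category_functor A D (Go \<circ> Fo) (Ga \<circ> Fa)"
proof -
  interpret F: category_functor A B Fo Fa by fact
  interpret G: category_functor B D Go Ga by fact
  show ?thesis
  proof
    fix f x y g z assume "f \<in> Hom A x y" "g \<in> Hom A y z"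
    then show "(Ga \<circ> Fa) (g \<cdot>\<^bsub>A\<^esub> f) = (Ga \<circ> Fa) g \<cdot>\<^bsub>D\<^esub> (Ga \<circ> Fa) f"
      using G.map_comp[OF F.map_hom F.map_hom] by (simp add: F.map_comp)
  qed (auto simp: F.map_obj G.map_obj F.map_ident G.map_ident intro: F.map_hom G.map_hom)
qed

text \<open>Choosing preimages of objects gives \<open>Fo (Go b) = b\<close> exactly, so the counit
  consists of identities. Arrows are lifted through the bijections on hom-sets, and every equation
  in \<open>A\<close> is checked after applying the faithful \<open>Fa\<close>.\<close>

lemma equivalent_categoriesI:
  assumes "category_functor A B Fo Fa"
    and fully_faithful: "\<And>x y. x \<in> Obj A \<Longrightarrow> y \<in> Obj A \<Longrightarrow>
      bij_betw Fa (Hom A x y) (Hom B (Fo x) (Fo y))"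
    and surjective: "Obj B \<subseteq> Fo ` Obj A"
  shows "equivalent_categories A B"
proof -
  interpret category_functor A B Fo Fa by fact
  define Go where "Go = inv_into (Obj A) Fo"
  \<comment> \<open>\<open>Fa\<close> is injective only within one hom-set, so a lift depends on the
    chosen source and target.\<close>
  define lift where "lift x y = inv_into (Hom A x y) Fa" for x y
  define Ga where "Ga f = lift (Go (Dom B f)) (Go (Cod B f)) f" for f
  have Go: "Go b \<in> Obj A" "Fo (Go b) = b" if "b \<in> Obj B" for b
    using that surjective by (auto simp: Go_def inv_into_into f_inv_into_f)
  have lift: "lift x y f \<in> Hom A x y" "Fa (lift x y f) = f"
    if "x \<in> Obj A" "y \<in> Obj A" "f \<in> Hom B (Fo x) (Fo y)" for x y f
    using that bij_betw_imp_surj_on[OF fully_faithful]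
    by (auto simp: lift_def inv_into_into f_inv_into_f)
  have eqI: "f = g" if "f \<in> Hom A x y" "g \<in> Hom A x y" "Fa f = Fa g" for f g x y
  proof -
    have "x \<in> Obj A" "y \<in> Obj A"
      using that(1) A.dom_obj A.cod_obj by (auto simp: Hom_def)
    from fully_faithful[OF this] that show ?thesis
      by (auto simp: bij_betw_def inj_on_def)
  qed
  have objB: "x \<in> Obj B" "y \<in> Obj B" if "f \<in> Hom B x y" for f x y
    using that B.dom_obj B.cod_obj by (auto simp: Hom_def)
  have objA: "x \<in> Obj A" "y \<in> Obj A" if "f \<in> Hom A x y" for f x y
    using that A.dom_obj A.cod_obj by (auto simp: Hom_def)
  have Ga: "Ga f \<in> Hom A (Go x) (Go y)" "Fa (Ga f) = f" if "f \<in> Hom B x y" for f x y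
    using lift[of "Go x" "Go y" f] that objB[OF that] Go by (auto simp: Ga_def Hom_def)
  have G: "category_functor B A Go Ga"
  proof (unfold_locales, goal_cases)
    case (1 x) then show ?case by (rule Go)
  next
    case (2 f x y) then show ?case by (rule Ga)
  next
    case (3 x)
    then have id: "\<one>\<^bsub>B\<^esub> x \<in> Hom B x x" by (rule B.ident_hom)
    show ?case
    proof (rule eqI)
      show "Ga (\<one>\<^bsub>B\<^esub> x) \<in> Hom A (Go x) (Go x)" by (rule Ga[OF id])
    qed (simp_all add: Ga[OF id] A.ident_hom map_ident Go 3)
  next
    case (4 f x y g z)
    then have gf: "g \<cdot>\<^bsub>B\<^esub> f \<in> Hom B x z" by (rule B.comp_hom)
    show ?case
    proof (rule eqI)
      show "Ga (g \<cdot>\<^bsub>B\<^esub> f) \<in> Hom A (Go x) (Go z)" by (rule Ga[OF gf])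
      show "Ga g \<cdot>\<^bsub>A\<^esub> Ga f \<in> Hom A (Go x) (Go z)"
        using Ga(1) 4 by (blast intro: A.comp_hom)
      show "Fa (Ga (g \<cdot>\<^bsub>B\<^esub> f)) = Fa (Ga g \<cdot>\<^bsub>A\<^esub> Ga f)"
        using Ga 4 gf map_comp by metis
    qed
  qed
  \<comment> \<open>Since \<open>Fo (Go (Fo x)) = Fo x\<close>, the identity of \<open>Fo x\<close>
    lifts in both directions; the two lifts are mutually inverse because their composites lie over
    identities.\<close>
  define \<eta> where "\<eta> x = lift x (Go (Fo x)) (\<one>\<^bsub>B\<^esub> (Fo x))" for x
  define \<eta>' where "\<eta>' x = lift (Go (Fo x)) x (\<one>\<^bsub>B\<^esub> (Fo x))" for x
  have \<eta>: "\<eta> x \<in> Hom A x (Go (Fo x))" "Fa (\<eta> x) = \<one>\<^bsub>B\<^esub> (Fo x)"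
    and \<eta>': "\<eta>' x \<in> Hom A (Go (Fo x)) x" "Fa (\<eta>' x) = \<one>\<^bsub>B\<^esub> (Fo x)"
    and GFo: "Go (Fo x) \<in> Obj A" "Fo (Go (Fo x)) = Fo x" if "x \<in> Obj A" for x
    using that lift[of x "Go (Fo x)" "\<one>\<^bsub>B\<^esub> (Fo x)"] lift[of "Go (Fo x)" x "\<one>\<^bsub>B\<^esub> (Fo x)"]
    by (simp_all add: \<eta>_def \<eta>'_def map_obj Go B.ident_hom)
  have id_A: "category_functor A A id id"
    by unfold_locales auto
  have id_B: "category_functor B B id id"
    by unfold_locales auto
  have GF: "category_functor A A (Go \<circ> Fo) (Ga \<circ> Fa)"
    using assms(1) G by (rule category_functor_comp)
  have FG: "category_functor B B (Fo \<circ> Go) (Fa \<circ> Ga)"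
    using G assms(1) by (rule category_functor_comp)
  have unit: "natural_isomorphism A A id id (Go \<circ> Fo) (Ga \<circ> Fa) \<eta>"
  proof (rule natural_isomorphism.intro[OF id_A GF], unfold_locales, goal_cases)
    case (1 x) then show ?case by (simp add: \<eta>)
  next
    case (2 x)
    note x = \<eta>[OF 2] \<eta>'[OF 2] GFo[OF 2]
    have idB: "\<one>\<^bsub>B\<^esub> (Fo x) \<in> Hom B (Fo x) (Fo x)"
      using 2 by (simp add: B.ident_hom map_obj)
    have "\<eta>' x \<cdot>\<^bsub>A\<^esub> \<eta> x = \<one>\<^bsub>A\<^esub> x"
    proof (rule eqI)
      show "\<eta>' x \<cdot>\<^bsub>A\<^esub> \<eta> x \<in> Hom A x x" using x by (blast intro: A.comp_hom)
    qed (use 2 x idB in \<open>simp_all add: A.ident_hom map_comp[OF x(1,3)] map_ident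
      B.ident_comp[OF idB]\<close>)
    moreover have "\<eta> x \<cdot>\<^bsub>A\<^esub> \<eta>' x = \<one>\<^bsub>A\<^esub> (Go (Fo x))"
    proof (rule eqI)
      show "\<eta> x \<cdot>\<^bsub>A\<^esub> \<eta>' x \<in> Hom A (Go (Fo x)) (Go (Fo x))"
        using x by (blast intro: A.comp_hom)
    qed (use 2 x idB in \<open>simp_all add: A.ident_hom map_comp[OF x(3,1)] map_ident
      B.ident_comp[OF idB]\<close>)
    ultimately show ?case
      using x by (auto simp: iso_arrow_def Hom_def)
  next
    case (3 f x y)
    note xy = objA[OF 3]
    note h = map_hom[OF 3]
    note Gh = Ga[OF h]
    show ?case
    proof (rule eqI)
      show "\<eta> y \<cdot>\<^bsub>A\<^esub> id f \<in> Hom A x (Go (Fo y))"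
        using 3 \<eta>[OF xy(2)] by (auto intro: A.comp_hom)
      show "(Ga \<circ> Fa) f \<cdot>\<^bsub>A\<^esub> \<eta> x \<in> Hom A x (Go (Fo y))"
        using Gh \<eta>[OF xy(1)] by (auto intro: A.comp_hom)
      show "Fa (\<eta> y \<cdot>\<^bsub>A\<^esub> id f) = Fa ((Ga \<circ> Fa) f \<cdot>\<^bsub>A\<^esub> \<eta> x)"
        using map_comp[OF 3 \<eta>(1)[OF xy(2)]] map_comp[OF \<eta>(1)[OF xy(1)] Gh(1)]
        by (simp add: \<eta> xy Gh B.ident_comp[OF h] B.comp_ident[OF h])
    qed
  qed
  have counit: "natural_isomorphism B B (Fo \<circ> Go) (Fa \<circ> Ga) id id (Ident B)"
  proof (rule natural_isomorphism.intro[OF FG id_B], unfold_locales, goal_cases)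
    case (1 x) then show ?case by (simp add: Go B.ident_hom)
  next
    case (2 x)
    then have "\<one>\<^bsub>B\<^esub> x \<in> Hom B x x" by (rule B.ident_hom)
    then show ?case
      by (auto simp: iso_arrow_def Hom_def B.ident_comp[of _ x x] intro!: bexI[of _ "\<one>\<^bsub>B\<^esub> x"])
  next
    case (3 f x y)
    then show ?case by (simp add: Ga B.ident_comp B.comp_ident)
  qed
  show ?thesis
    unfolding equivalent_categories_def
    using assms(1) G unit counit by blast
qed

section \<open>Composition, pullback squares and pushout squares\<close>

context category
begin

lemma hom_iff: "f \<in> Hom C x y \<longleftrightarrow> f \<in> Arr C \<and> Dom C f = x \<and> Cod C f = y"
  by (simp add: Hom_def)

text \<open>Typing is phrased with \<open>Arr\<close>, \<open>Dom\<close> and \<open>Cod\<close>, so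
  that the simplifier computes the source and target of a composite instead of having to guess the
  middle object of a \<open>Hom\<close> rule.\<close>

lemma comp_simps [simp]:
  assumes "f \<in> Arr C" "g \<in> Arr C" "Dom C g = Cod C f"
  shows "g \<cdot> f \<in> Arr C" "Dom C (g \<cdot> f) = Dom C f" "Cod C (g \<cdot> f) = Cod C g"
  using assms comp_hom[of f "Dom C f" "Cod C f" g "Cod C g"] by (auto simp: hom_iff)

lemma assoc [simp]:
  assumes "f \<in> Arr C" "g \<in> Arr C" "h \<in> Arr C" "Dom C g = Cod C f" "Dom C h = Cod C g"
  shows "(h \<cdot> g) \<cdot> f = h \<cdot> (g \<cdot> f)"
  using assms comp_assoc[of f _ _ g _ h] by (auto simp: hom_iff)

lemma ident_simps [simp]:
  assumes "x \<in> Obj C"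
  shows "\<one> x \<in> Arr C" "Dom C (\<one> x) = x" "Cod C (\<one> x) = x"
  using ident_hom[OF assms] by (auto simp: hom_iff)

lemma comp_ident_simps [simp]:
  assumes "f \<in> Arr C"
  shows "Dom C f = x \<Longrightarrow> f \<cdot> \<one> x = f" "Cod C f = x \<Longrightarrow> \<one> x \<cdot> f = f"
  using assms by (auto intro: comp_ident ident_comp simp: hom_iff)

declare dom_obj [simp] cod_obj [simp]

text \<open>Composites are normalized by nesting to the right, which hides the left side of an
  equation inside a longer composite. This form, and \<open>comp_eq\<close> for a single arrow on
  the right, makes such equations applicable there.\<close>

lemma comp_eq_comp:
  assumes "g \<cdot> f = g' \<cdot> f'" "f \<in> Arr C" "g \<in> Arr C" "Dom C g = Cod C f"
    "f' \<in> Arr C" "g' \<in> Arr C" "Dom C g' = Cod C f'" "k \<in> Arr C" "Cod C k = Dom C f"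
    "Dom C f = Dom C f'"
  shows "g \<cdot> (f \<cdot> k) = g' \<cdot> (f' \<cdot> k)"
proof -
  have "g \<cdot> (f \<cdot> k) = (g \<cdot> f) \<cdot> k" using assms(2-9) by simp
  also have "\<dots> = (g' \<cdot> f') \<cdot> k" using assms(1) by simp
  also have "\<dots> = g' \<cdot> (f' \<cdot> k)" using assms(2-) by simp
  finally show ?thesis .
qed

lemma comp_eq:
  assumes "g \<cdot> f = h" "f \<in> Arr C" "g \<in> Arr C" "Dom C g = Cod C f"
    "k \<in> Arr C" "Cod C k = Dom C f"
  shows "g \<cdot> (f \<cdot> k) = h \<cdot> k"
proof -
  have "g \<cdot> (f \<cdot> k) = (g \<cdot> f) \<cdot> k" using assms(2-) by simp
  then show ?thesis by (simp only: assms(1))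
qed

lemma pullback_pairing:
  assumes "pullback_square C p1 p2 d c"
    and "u \<in> Hom C X (Dom C d)" "v \<in> Hom C X (Dom C c)" "d \<cdot> u = c \<cdot> v"
  shows "pairing C p1 p2 u v \<in> Hom C X (Dom C p1)"
    "p1 \<cdot> pairing C p1 p2 u v = u" "p2 \<cdot> pairing C p1 p2 u v = v"
proof -
  have "\<exists>!h. h \<in> Hom C X (Dom C p1) \<and> p1 \<cdot> h = u \<and> p2 \<cdot> h = v"
    using assms by (simp add: pullback_square_def)
  moreover have "Dom C u = X" using assms by (simp add: hom_iff)
  ultimately have "pairing C p1 p2 u v \<in> Hom C X (Dom C p1) \<and>
      p1 \<cdot> pairing C p1 p2 u v = u \<and> p2 \<cdot> pairing C p1 p2 u v = v"
    unfolding pairing_def by (simp only:) (rule theI')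
  then show "pairing C p1 p2 u v \<in> Hom C X (Dom C p1)"
    "p1 \<cdot> pairing C p1 p2 u v = u" "p2 \<cdot> pairing C p1 p2 u v = v"
    by auto
qed

lemma pullback_eqI:
  assumes pb: "pullback_square C p1 p2 d c"
    and h: "h \<in> Hom C X (Dom C p1)" "k \<in> Hom C X (Dom C p1)"
    and eq: "p1 \<cdot> h = p1 \<cdot> k" "p2 \<cdot> h = p2 \<cdot> k"
  shows "h = k"
proof -
  have sq: "commutative_square C p1 p2 d c" using pb by (simp add: pullback_square_def)
  then have "p1 \<cdot> k \<in> Hom C X (Dom C d)" "p2 \<cdot> k \<in> Hom C X (Dom C c)"
      "d \<cdot> (p1 \<cdot> k) = c \<cdot> (p2 \<cdot> k)"
    using h comp_eq_comp[of d p1 c p2 k] by (auto simp: commutative_square_def hom_iff)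
  then have "\<exists>!l. l \<in> Hom C X (Dom C p1) \<and> p1 \<cdot> l = p1 \<cdot> k \<and> p2 \<cdot> l = p2 \<cdot> k"
    using pb by (simp add: pullback_square_def)
  then show ?thesis using h eq by blast
qed

lemma pairing_eqI:
  assumes pb: "pullback_square C p1 p2 d c"
    and h: "h \<in> Hom C X (Dom C p1)" "p1 \<cdot> h = u" "p2 \<cdot> h = v"
  shows "pairing C p1 p2 u v = h"
proof -
  have sq: "commutative_square C p1 p2 d c" using pb by (simp add: pullback_square_def)
  then have "Dom C (p1 \<cdot> h) = X"
    using h(1) by (simp add: commutative_square_def hom_iff)
  then have "Dom C u = X" by (simp only: h(2))
  show ?thesis
    unfolding pairing_def \<open>Dom C u = X\<close>
  proof (rule the_equality)
    show "h \<in> Hom C X (Dom C p1) \<and> p1 \<cdot> h = u \<and> p2 \<cdot> h = v"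
      using h by (intro conjI)
    fix k assume "k \<in> Hom C X (Dom C p1) \<and> p1 \<cdot> k = u \<and> p2 \<cdot> k = v"
    then show "k = h"
      by (intro pullback_eqI[OF pb _ h(1)]) (simp_all only: h(2,3))
  qed
qed

lemma pullback_squareI:
  assumes "commutative_square C p1 p2 d c"
    and "\<And>X u v. \<lbrakk>u \<in> Hom C X (Dom C d); v \<in> Hom C X (Dom C c); d \<cdot> u = c \<cdot> v\<rbrakk> \<Longrightarrow>
      \<exists>h. h \<in> Hom C X (Dom C p1) \<and> p1 \<cdot> h = u \<and> p2 \<cdot> h = v"
    and "\<And>X h k. \<lbrakk>h \<in> Hom C X (Dom C p1); k \<in> Hom C X (Dom C p1);
      p1 \<cdot> h = p1 \<cdot> k; p2 \<cdot> h = p2 \<cdot> k\<rbrakk> \<Longrightarrow> h = k"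
  shows "pullback_square C p1 p2 d c"
  unfolding pullback_square_def
proof (intro conjI allI ballI impI)
  show "commutative_square C p1 p2 d c" by fact
next
  fix X u v
  assume "u \<in> Hom C X (Dom C d)" "v \<in> Hom C X (Dom C c)" "d \<cdot> u = c \<cdot> v"
  from assms(2)[OF this] obtain h where "h \<in> Hom C X (Dom C p1)" "p1 \<cdot> h = u" "p2 \<cdot> h = v"
    by auto
  then show "\<exists>!h. h \<in> Hom C X (Dom C p1) \<and> p1 \<cdot> h = u \<and> p2 \<cdot> h = v"
    by (intro ex1I[of _ h]) (auto intro: assms(3))
qed

lemma pushout_eqI:
  assumes po: "pushout_square C p1 p2 d c"
    and h: "h \<in> Hom C (Cod C d) X" "k \<in> Hom C (Cod C d) X"
    and eq: "h \<cdot> d = k \<cdot> d" "h \<cdot> c = k \<cdot> c"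
  shows "h = k"
proof -
  have sq: "commutative_square C p1 p2 d c" using po by (simp add: pushout_square_def)
  then have "k \<cdot> d \<in> Hom C (Cod C p1) X" "k \<cdot> c \<in> Hom C (Cod C p2) X"
      "(k \<cdot> d) \<cdot> p1 = (k \<cdot> c) \<cdot> p2"
    using h by (auto simp: commutative_square_def hom_iff)
  then have "\<exists>!l. l \<in> Hom C (Cod C d) X \<and> l \<cdot> d = k \<cdot> d \<and> l \<cdot> c = k \<cdot> c"
    using po unfolding pushout_square_def by blast
  then show ?thesis using h eq by blast
qed

text \<open>Composing \<open>u \<cdot> p1 = v \<cdot> p2\<close> with \<open>s\<close> and
  \<open>t\<close> expresses \<open>u\<close> and \<open>v\<close> through each other, whence
  \<open>u \<cdot> b = v \<cdot> a\<close>. This common arrow is the mediating one, and it is unique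
  because \<open>d \<cdot> b = \<one> Z\<close>. The argument is purely equational, so no colimits
  need to exist.\<close>

lemma split_pushout_square:
  assumes arrows: "p1 \<in> Hom C P A" "p2 \<in> Hom C P B" "d \<in> Hom C A Z" "c \<in> Hom C B Z"
      "s \<in> Hom C A P" "t \<in> Hom C B P" "a \<in> Hom C Z B" "b \<in> Hom C Z A"
    and square: "d \<cdot> p1 = c \<cdot> p2"
    and eqs: "p1 \<cdot> s = \<one> A" "p2 \<cdot> s = a \<cdot> d" "p1 \<cdot> t = b \<cdot> c" "p2 \<cdot> t = \<one> B"
      "d \<cdot> b = \<one> Z" "c \<cdot> a = \<one> Z"
  shows "pushout_square C p1 p2 d c"
  unfolding pushout_square_def
proof (intro conjI allI ballI impI)
  show "commutative_square C p1 p2 d c"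
    using arrows square by (simp add: commutative_square_def hom_iff)
next
  fix X u v
  assume uv: "u \<in> Hom C (Cod C p1) X" "v \<in> Hom C (Cod C p2) X" "u \<cdot> p1 = v \<cdot> p2"
  then have "u \<in> Hom C A X" "v \<in> Hom C B X"
    using arrows by (simp_all add: hom_iff)
  note ty = this[unfolded hom_iff] arrows[unfolded hom_iff]
  have u: "u = v \<cdot> (a \<cdot> d)"
    using comp_eq_comp[OF uv(3), of s] ty eqs(1,2) by simp
  have v: "v = u \<cdot> (b \<cdot> c)"
    using comp_eq_comp[OF uv(3), of t] ty eqs(3,4) by simp
  have "u \<cdot> b = (v \<cdot> (a \<cdot> d)) \<cdot> b"
    using u by (rule arg_cong)
  also have "\<dots> = v \<cdot> a"
    using ty eqs(5) by simp
  finally have ub: "u \<cdot> b = v \<cdot> a" .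
  have va_d: "(v \<cdot> a) \<cdot> d = u"
    using ty u[symmetric] by simp
  have "(u \<cdot> b) \<cdot> c = v"
    using ty v[symmetric] by simp
  then have va_c: "(v \<cdot> a) \<cdot> c = v"
    by (simp only: ub)
  have va: "v \<cdot> a \<in> Hom C (Cod C d) X"
    using ty by (simp add: hom_iff)
  have unique: "h = v \<cdot> a" if "h \<in> Hom C (Cod C d) X" "h \<cdot> d = u" for h
  proof -
    have "h = h \<cdot> (d \<cdot> b)" using that(1) ty eqs(5) by (simp add: hom_iff)
    also have "\<dots> = (h \<cdot> d) \<cdot> b" using that(1) ty by (simp add: hom_iff)
    finally show ?thesis by (simp only: that(2) ub)
  qed
  show "\<exists>!h. h \<in> Hom C (Cod C d) X \<and> h \<cdot> d = u \<and> h \<cdot> c = v"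
    by (intro ex1I[of _ "v \<cdot> a"] conjI va va_d va_c) (elim conjE, rule unique)
qed

end

section \<open>Calculus of generalized elements\<close>

text \<open>Associativity and the laws \<open>i \<cdot> i = \<one> C1\<close> and
  \<open>i \<cdot> e = e\<close> are left out: for a link the first needs an argument of its own,
  and the other two are then consequences of cancellation.\<close>

locale groupoid_data = category C
  for C :: "('o, 'a) cat" (structure) +
  fixes C0 C1 C2 :: 'o
    and \<pi>1 \<pi>2 m d c e i :: 'a
  assumes arrows: "\<pi>1 \<in> Hom C C2 C1" "\<pi>2 \<in> Hom C C2 C1" "m \<in> Hom C C2 C1"
      "d \<in> Hom C C1 C0" "c \<in> Hom C C1 C0" "e \<in> Hom C C0 C1" "i \<in> Hom C C1 C1"
    and reflexive: "d \<cdot> e = \<one> C0" "c \<cdot> e = \<one> C0"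
    and boundary: "d \<cdot> m = d \<cdot> \<pi>2" "c \<cdot> m = c \<cdot> \<pi>1" "d \<cdot> \<pi>1 = c \<cdot> \<pi>2"
    and reversal: "d \<cdot> i = c" "c \<cdot> i = d"
    and composable: "pullback_square C \<pi>1 \<pi>2 d c"
    and units: "m \<cdot> pairing C \<pi>1 \<pi>2 (\<one> C1) (e \<cdot> d) = \<one> C1"
      "m \<cdot> pairing C \<pi>1 \<pi>2 (e \<cdot> c) (\<one> C1) = \<one> C1"
    and inverses: "m \<cdot> pairing C \<pi>1 \<pi>2 (\<one> C1) i = e \<cdot> c"
      "m \<cdot> pairing C \<pi>1 \<pi>2 i (\<one> C1) = e \<cdot> d"
begin

abbreviation pair ("\<langle>_,/ _\<rangle>") where "\<langle>x, y\<rangle> \<equiv> pairing C \<pi>1 \<pi>2 x y"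
abbreviation mult (infixr "\<star>" 65) where "x \<star> y \<equiv> m \<cdot> \<langle>x, y\<rangle>"

text \<open>An arrow X -> \<open>C1\<close> is an element of \<open>C1\<close> at stage X, and
  \<open>\<langle>x, y\<rangle>\<close> is the element of \<open>C2\<close> at X with these
  components. All typing conditions are bundled in, so that this is the only side condition of the
  calculus.\<close>

definition composable_elements :: "'a \<Rightarrow> 'a \<Rightarrow> bool" where
  "composable_elements x y \<longleftrightarrow> x \<in> Arr C \<and> y \<in> Arr C \<and> Dom C x = Dom C y \<and>
    Cod C x = C1 \<and> Cod C y = C1 \<and> d \<cdot> x = c \<cdot> y"

lemma typing [simp]:
  "\<pi>1 \<in> Arr C" "\<pi>2 \<in> Arr C" "m \<in> Arr C" "d \<in> Arr C" "c \<in> Arr C" "e \<in> Arr C" "i \<in> Arr C"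
  "Dom C \<pi>1 = C2" "Dom C \<pi>2 = C2" "Dom C m = C2" "Dom C d = C1" "Dom C c = C1"
  "Dom C e = C0" "Dom C i = C1"
  "Cod C \<pi>1 = C1" "Cod C \<pi>2 = C1" "Cod C m = C1" "Cod C d = C0" "Cod C c = C0"
  "Cod C e = C1" "Cod C i = C1"
  using arrows by (simp_all add: hom_iff)

lemma objects [simp]: "C0 \<in> Obj C" "C1 \<in> Obj C" "C2 \<in> Obj C"
  using dom_obj[of e] dom_obj[of d] dom_obj[of m] by simp_all

lemma pair_simps [simp]:
  assumes "composable_elements x y"
  shows "\<langle>x, y\<rangle> \<in> Arr C" "Dom C \<langle>x, y\<rangle> = Dom C x" "Cod C \<langle>x, y\<rangle> = C2"
    "\<pi>1 \<cdot> \<langle>x, y\<rangle> = x" "\<pi>2 \<cdot> \<langle>x, y\<rangle> = y"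
  using pullback_pairing[OF composable, of x "Dom C x" y] assms
  by (auto simp: composable_elements_def hom_iff)

lemma boundary_comp [simp]:
  assumes "k \<in> Arr C"
  shows "Cod C k = C2 \<Longrightarrow> d \<cdot> (m \<cdot> k) = d \<cdot> (\<pi>2 \<cdot> k)"
    "Cod C k = C2 \<Longrightarrow> c \<cdot> (m \<cdot> k) = c \<cdot> (\<pi>1 \<cdot> k)"
    "Cod C k = C2 \<Longrightarrow> d \<cdot> (\<pi>1 \<cdot> k) = c \<cdot> (\<pi>2 \<cdot> k)"
    "Cod C k = C1 \<Longrightarrow> d \<cdot> (i \<cdot> k) = c \<cdot> k"
    "Cod C k = C1 \<Longrightarrow> c \<cdot> (i \<cdot> k) = d \<cdot> k"
    "Cod C k = C0 \<Longrightarrow> d \<cdot> (e \<cdot> k) = k"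
    "Cod C k = C0 \<Longrightarrow> c \<cdot> (e \<cdot> k) = k"
  using assms comp_eq_comp[OF boundary(1)] comp_eq_comp[OF boundary(2)]
    comp_eq_comp[OF boundary(3)] comp_eq[OF reversal(1)] comp_eq[OF reversal(2)]
    comp_eq[OF reflexive(1)] comp_eq[OF reflexive(2)]
  by simp_all

declare boundary [simp] reversal [simp] reflexive [simp]

lemma pair_eqI:
  assumes "h \<in> Hom C X C2" "k \<in> Hom C X C2" "\<pi>1 \<cdot> h = \<pi>1 \<cdot> k" "\<pi>2 \<cdot> h = \<pi>2 \<cdot> k"
  shows "h = k"
  using pullback_eqI[OF composable, of h X k] assms by simp

lemma composable_comp [simp]:
  assumes "composable_elements x y" "k \<in> Arr C" "Cod C k = Dom C x"
  shows "composable_elements (x \<cdot> k) (y \<cdot> k)"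
  using assms comp_eq_comp[of d x c y k] by (auto simp: composable_elements_def)

text \<open>Change of stage: precomposition acts on elements componentwise. It turns equations
  between arrows into equations valid for all elements.\<close>

lemma pair_comp [simp]:
  assumes "composable_elements x y" "k \<in> Arr C" "Cod C k = Dom C x"
  shows "\<langle>x, y\<rangle> \<cdot> k = \<langle>x \<cdot> k, y \<cdot> k\<rangle>"
proof (rule pair_eqI)
  have ty: "x \<in> Arr C" "y \<in> Arr C" "Dom C y = Dom C x"
    using assms(1) by (simp_all add: composable_elements_def)
  show "\<langle>x, y\<rangle> \<cdot> k \<in> Hom C (Dom C k) C2" "\<langle>x \<cdot> k, y \<cdot> k\<rangle> \<in> Hom C (Dom C k) C2"
    using assms ty by (simp_all add: hom_iff)
  show "\<pi>1 \<cdot> (\<langle>x, y\<rangle> \<cdot> k) = \<pi>1 \<cdot> \<langle>x \<cdot> k, y \<cdot> k\<rangle>"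
    using comp_eq[of \<pi>1 "\<langle>x, y\<rangle>" x k] assms by simp
  show "\<pi>2 \<cdot> (\<langle>x, y\<rangle> \<cdot> k) = \<pi>2 \<cdot> \<langle>x \<cdot> k, y \<cdot> k\<rangle>"
    using comp_eq[of \<pi>2 "\<langle>x, y\<rangle>" y k] assms by simp
qed

lemma composable_projections: "composable_elements \<pi>1 \<pi>2"
  by (simp add: composable_elements_def)

lemma composable_projections_comp:
  "k \<in> Arr C \<Longrightarrow> Cod C k = C2 \<Longrightarrow> composable_elements (\<pi>1 \<cdot> k) (\<pi>2 \<cdot> k)"
  using composable_comp[OF composable_projections] by simp

lemma pair_projections:
  assumes "k \<in> Arr C" "Cod C k = C2"
  shows "\<langle>\<pi>1 \<cdot> k, \<pi>2 \<cdot> k\<rangle> = k"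
  by (rule pair_eqI[of _ "Dom C k"])
    (use assms composable_projections_comp[OF assms] in \<open>simp_all add: hom_iff\<close>)

text \<open>The generic pair (\<open>\<pi>1\<close>, \<open>\<pi>2\<close>) is already enough, since
  \<open>\<langle>\<pi>1, \<pi>2\<rangle>\<close> is the identity of \<open>C2\<close>.\<close>

lemma C2_eqI:
  assumes "f \<in> Hom C C2 Y" "g \<in> Hom C C2 Y"
    and "\<And>x y. composable_elements x y \<Longrightarrow> f \<cdot> \<langle>x, y\<rangle> = g \<cdot> \<langle>x, y\<rangle>"
  shows "f = g"
  using assms(3)[OF composable_projections] assms(1,2) pair_projections[of "\<one> C2"]
  by (simp add: hom_iff)

lemma composable_simps [simp]:
  assumes "x \<in> Arr C" "Cod C x = C1"
  shows "composable_elements x (e \<cdot> (d \<cdot> x))" "composable_elements (e \<cdot> (c \<cdot> x)) x"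
    "composable_elements x (i \<cdot> x)" "composable_elements (i \<cdot> x) x"
  using assms by (simp_all add: composable_elements_def)

text \<open>The axiom is the case of the generic element \<open>\<one> C1\<close>; precomposing it
  with \<open>x\<close> gives the law for \<open>x\<close>. The next three lemmas arise in the same
  way.\<close>

lemma unit_right:
  assumes "x \<in> Arr C" "Cod C x = C1"
  shows "x \<star> e \<cdot> (d \<cdot> x) = x"
  using comp_eq[OF units(1), of x] assms composable_simps(1)[of "\<one> C1"] by simp

lemma unit_left:
  assumes "x \<in> Arr C" "Cod C x = C1"
  shows "e \<cdot> (c \<cdot> x) \<star> x = x"
  using comp_eq[OF units(2), of x] assms composable_simps(2)[of "\<one> C1"] by simp

lemma inverse_right:
  assumes "x \<in> Arr C" "Cod C x = C1"
  shows "x \<star> i \<cdot> x = e \<cdot> (c \<cdot> x)"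
  using comp_eq[OF inverses(1), of x] assms composable_simps(3)[of "\<one> C1"] by simp

lemma inverse_left:
  assumes "x \<in> Arr C" "Cod C x = C1"
  shows "i \<cdot> x \<star> x = e \<cdot> (d \<cdot> x)"
  using comp_eq[OF inverses(2), of x] assms composable_simps(4)[of "\<one> C1"] by simp

lemma mult_simps [simp]:
  assumes "composable_elements x y"
  shows "d \<cdot> (x \<star> y) = d \<cdot> y" "c \<cdot> (x \<star> y) = c \<cdot> x"
  using assms by simp_all

lemma composableE:
  assumes "composable_elements x y"
  shows "x \<in> Arr C" "y \<in> Arr C" "Dom C y = Dom C x" "Cod C x = C1" "Cod C y = C1"
    "d \<cdot> x = c \<cdot> y"
  using assms by (simp_all add: composable_elements_def)

lemma composable_mult:
  assumes "composable_elements x y"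
  shows "composable_elements y z \<Longrightarrow> composable_elements (x \<star> y) z"
    "composable_elements z x \<Longrightarrow> composable_elements z (x \<star> y)"
    "composable_elements (i \<cdot> x) (x \<star> y)" "composable_elements (x \<star> y) (i \<cdot> y)"
    "composable_elements (i \<cdot> y) (i \<cdot> x)"
  using assms composableE[OF assms] mult_simps[OF assms] pair_simps[OF assms]
  by (simp_all add: composable_elements_def)

section \<open>Associativity on an object of composable triples\<close>

context
  fixes q1 q2
  assumes triples: "pullback_square C q1 q2 (d \<cdot> \<pi>2) c"
begin

lemma triples_typing:
  "q1 \<in> Arr C" "q2 \<in> Arr C" "Dom C q2 = Dom C q1" "Cod C q1 = C2" "Cod C q2 = C1"
  "d \<cdot> (\<pi>2 \<cdot> q1) = c \<cdot> q2"
proof -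
  have sq: "commutative_square C q1 q2 (d \<cdot> \<pi>2) c"
    using triples by (simp add: pullback_square_def)
  then show ty: "q1 \<in> Arr C" "q2 \<in> Arr C" "Dom C q2 = Dom C q1" "Cod C q1 = C2" "Cod C q2 = C1"
    by (auto simp: commutative_square_def)
  show "d \<cdot> (\<pi>2 \<cdot> q1) = c \<cdot> q2"
    using sq ty by (simp add: commutative_square_def)
qed

lemma triples_composable:
  "composable_elements (\<pi>1 \<cdot> q1) (\<pi>2 \<cdot> q1)" "composable_elements (\<pi>2 \<cdot> q1) q2"
  "composable_elements (m \<cdot> q1) q2" "composable_elements (\<pi>1 \<cdot> q1) (\<pi>2 \<cdot> q1 \<star> q2)"
proof -
  note ty = triples_typing
  show 1: "composable_elements (\<pi>1 \<cdot> q1) (\<pi>2 \<cdot> q1)"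
    using composable_projections_comp[of q1] ty by simp
  show 2: "composable_elements (\<pi>2 \<cdot> q1) q2"
    using ty by (simp add: composable_elements_def)
  show "composable_elements (m \<cdot> q1) q2"
    using ty by (simp add: composable_elements_def)
  show "composable_elements (\<pi>1 \<cdot> q1) (\<pi>2 \<cdot> q1 \<star> q2)"
    using composable_mult(2)[OF 2 1] .
qed

text \<open>The components of (\<open>q1\<close>, \<open>q2\<close>) form the generic composable
  triple: any x, y, z factor through it by the \<open>h\<close> of the proof, and the equation is
  precomposed with \<open>h\<close>.\<close>

lemma element_assoc_if_triple_assoc:
  assumes eq: "\<pi>1 \<cdot> q1 \<star> \<pi>2 \<cdot> q1 \<star> q2 = m \<cdot> q1 \<star> q2"
    and co: "composable_elements x y" "composable_elements y z"
  shows "(x \<star> y) \<star> z = x \<star> y \<star> z"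
proof -
  note ty = composableE[OF co(1)] composableE[OF co(2)]
  define h where "h = pairing C q1 q2 \<langle>x, y\<rangle> z"
  have h: "h \<in> Arr C" "Cod C h = Dom C q1" "q1 \<cdot> h = \<langle>x, y\<rangle>" "q2 \<cdot> h = z"
    using pullback_pairing[OF triples, of "\<langle>x, y\<rangle>" "Dom C x" z] ty co triples_typing
    by (auto simp: hom_iff h_def)
  have "(\<pi>1 \<cdot> q1 \<star> \<pi>2 \<cdot> q1 \<star> q2) \<cdot> h = (m \<cdot> q1 \<star> q2) \<cdot> h"
    by (simp only: eq)
  then show ?thesis
    using h triples_typing triples_composable(2-4) co by simp
qed

end

end

text \<open>Associativity for elements refers to no chosen object of triples, so it can be supplied
  both by a groupoid and by the \<open>m1\<close>, \<open>m2\<close> of a link.\<close>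

locale groupoid_laws = groupoid_data +
  assumes element_assoc: "\<And>x y z. \<lbrakk>composable_elements x y; composable_elements y z\<rbrakk> \<Longrightarrow>
    (x \<star> y) \<star> z = x \<star> y \<star> z"
begin

lemma inverse_mult_cancel:
  assumes "composable_elements x y"
  shows "i \<cdot> x \<star> x \<star> y = y"
proof -
  note ty = composableE[OF assms]
  have "i \<cdot> x \<star> x \<star> y = (i \<cdot> x \<star> x) \<star> y"
    using element_assoc[of "i \<cdot> x" x y] assms ty by simp
  also have "\<dots> = y"
    using ty unit_left[of y] by (simp add: inverse_left)
  finally show ?thesis .
qed

lemma mult_inverse_cancel:
  assumes "composable_elements x y"
  shows "(x \<star> y) \<star> i \<cdot> y = x"
proof -
  note ty = composableE[OF assms]
  have "(x \<star> y) \<star> i \<cdot> y = x \<star> y \<star> i \<cdot> y"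
    using element_assoc[of x y "i \<cdot> y"] assms ty by simp
  also have "\<dots> = x"
    using ty unit_right[of x] by (simp add: inverse_right)
  finally show ?thesis .
qed

lemma left_cancel:
  assumes "composable_elements x y" "composable_elements x z" "x \<star> y = x \<star> z"
  shows "y = z"
  using arg_cong[OF assms(3), of "\<lambda>w. i \<cdot> x \<star> w"]
  by (simp only: assms(1,2) inverse_mult_cancel)

lemma right_cancel:
  assumes "composable_elements x z" "composable_elements y z" "x \<star> z = y \<star> z"
  shows "x = y"
  using arg_cong[OF assms(3), of "\<lambda>w. w \<star> i \<cdot> z"]
  by (simp only: assms(1,2) mult_inverse_cancel)

text \<open>Both sides multiplied on the right by \<open>i \<cdot> x\<close> give
  \<open>e \<cdot> (c \<cdot> x)\<close>.\<close>

lemma inverse_inverse [simp]: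
  assumes "x \<in> Arr C" "Cod C x = C1"
  shows "i \<cdot> (i \<cdot> x) = x"
  by (rule right_cancel[of _ "i \<cdot> x"])
    (use assms inverse_left[of "i \<cdot> x"] inverse_right[of x] composable_simps(4)[of "i \<cdot> x"] in simp_all)

lemma inverse_involutive: "i \<cdot> i = \<one> C1"
  using inverse_inverse[of "\<one> C1"] by simp

lemma inverse_unit: "i \<cdot> e = e"
  by (rule right_cancel[of _ e])
    (use inverse_left[of e] unit_right[of e] composable_simps(1,4)[of e] in simp_all)

lemma inverse_mult:
  assumes "composable_elements x y"
  shows "i \<cdot> (x \<star> y) = i \<cdot> y \<star> i \<cdot> x"
proof (rule right_cancel[of _ "x \<star> y"])
  note ty = composableE[OF assms]
  note co = composable_mult(3,5)[OF assms]
  show "composable_elements (i \<cdot> (x \<star> y)) (x \<star> y)"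
    using assms by simp
  show "composable_elements (i \<cdot> y \<star> i \<cdot> x) (x \<star> y)"
    by (rule composable_mult(1)[OF co(2,1)])
  have "(i \<cdot> y \<star> i \<cdot> x) \<star> x \<star> y = e \<cdot> (d \<cdot> y)"
    using element_assoc[OF co(2,1)] inverse_mult_cancel[OF assms] ty by (simp add: inverse_left)
  then show "i \<cdot> (x \<star> y) \<star> x \<star> y = (i \<cdot> y \<star> i \<cdot> x) \<star> x \<star> y"
    using inverse_left[of "x \<star> y"] assms by simp
qed

end

section \<open>The link of a groupoid\<close>

context groupoid_laws
begin

definition \<theta> where "\<theta> = \<langle>i \<cdot> \<pi>1, m\<rangle>"
definition \<phi> where "\<phi> = \<langle>m, i \<cdot> \<pi>2\<rangle>"
text \<open>The degenerate pairs (x, 1) and (1, x). They witness \<open>unital\<close> and also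
  split the squares that have to be pushouts.\<close>

definition e1 where "e1 = \<langle>\<one> C1, e \<cdot> d\<rangle>"
definition e2 where "e2 = \<langle>e \<cdot> c, \<one> C1\<rangle>"

lemma link_composable [simp]:
  "composable_elements (i \<cdot> \<pi>1) m" "composable_elements m (i \<cdot> \<pi>2)"
  "composable_elements (\<one> C1) (e \<cdot> d)" "composable_elements (e \<cdot> c) (\<one> C1)"
  by (simp_all add: composable_elements_def)

lemma link_typing [simp]:
  "\<theta> \<in> Arr C" "\<phi> \<in> Arr C" "Dom C \<theta> = C2" "Dom C \<phi> = C2" "Cod C \<theta> = C2" "Cod C \<phi> = C2"
  "e1 \<in> Arr C" "e2 \<in> Arr C" "Dom C e1 = C1" "Dom C e2 = C1" "Cod C e1 = C2" "Cod C e2 = C2"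
  by (simp_all add: \<theta>_def \<phi>_def e1_def e2_def)

lemma \<theta>_pair [simp]: "composable_elements x y \<Longrightarrow> \<theta> \<cdot> \<langle>x, y\<rangle> = \<langle>i \<cdot> x, x \<star> y\<rangle>"
  by (simp add: \<theta>_def)

lemma \<phi>_pair [simp]: "composable_elements x y \<Longrightarrow> \<phi> \<cdot> \<langle>x, y\<rangle> = \<langle>x \<star> y, i \<cdot> y\<rangle>"
  by (simp add: \<phi>_def)

lemma \<pi>_\<theta>_\<phi>: "\<pi>1 \<cdot> \<theta> = i \<cdot> \<pi>1" "\<pi>2 \<cdot> \<theta> = m" "\<pi>1 \<cdot> \<phi> = m" "\<pi>2 \<cdot> \<phi> = i \<cdot> \<pi>2"
  by (simp_all add: \<theta>_def \<phi>_def)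

lemma m_\<theta>: "m \<cdot> \<theta> = \<pi>2"
  by (rule C2_eqI) (simp_all add: hom_iff inverse_mult_cancel composableE composable_mult)

lemma m_\<phi>: "m \<cdot> \<phi> = \<pi>1"
  by (rule C2_eqI) (simp_all add: hom_iff mult_inverse_cancel composableE composable_mult)

lemma involutions: "\<theta> \<cdot> \<theta> = \<one> C2" "\<phi> \<cdot> \<phi> = \<one> C2"
  by (rule C2_eqI; simp add: hom_iff inverse_mult_cancel mult_inverse_cancel composableE
      composable_mult)+

text \<open>Both sides reverse the triangle: they send (x, y) to (y^-1, x^-1).\<close>

lemma braid: "\<theta> \<cdot> (\<phi> \<cdot> \<theta>) = \<phi> \<cdot> (\<theta> \<cdot> \<phi>)"
proof (rule C2_eqI)
  fix x y assume co: "composable_elements x y"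
  note ty = composableE[OF co]
  note mult = composable_mult(3-5)[OF co]
  \<comment> \<open>The path is (x, y), (x^-1, x y), (y, (x y)^-1); the other composite passes
    through (x y, y^-1) and ((x y)^-1, x).\<close>
  have "\<theta> \<cdot> (\<phi> \<cdot> (\<theta> \<cdot> \<langle>x, y\<rangle>)) = \<theta> \<cdot> \<langle>y, i \<cdot> (x \<star> y)\<rangle>"
    using co mult by (simp add: inverse_mult_cancel)
  also have "\<dots> = \<langle>i \<cdot> y, y \<star> i \<cdot> (x \<star> y)\<rangle>"
    using ty pair_simps[OF co] by (intro \<theta>_pair) (simp add: composable_elements_def)
  also have "y \<star> i \<cdot> (x \<star> y) = i \<cdot> x"
    using mult_inverse_cancel[OF mult(1)] inverse_mult_cancel[of "i \<cdot> y" "i \<cdot> x"] mult ty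
    by (simp add: inverse_mult[OF co])
  finally have 1: "\<theta> \<cdot> (\<phi> \<cdot> (\<theta> \<cdot> \<langle>x, y\<rangle>)) = \<langle>i \<cdot> y, i \<cdot> x\<rangle>" .
  have "\<phi> \<cdot> (\<theta> \<cdot> (\<phi> \<cdot> \<langle>x, y\<rangle>)) = \<phi> \<cdot> \<langle>i \<cdot> (x \<star> y), x\<rangle>"
    using co mult by (simp add: mult_inverse_cancel)
  also have "\<dots> = \<langle>i \<cdot> (x \<star> y) \<star> x, i \<cdot> x\<rangle>"
    using ty pair_simps[OF co] by (intro \<phi>_pair) (simp add: composable_elements_def)
  also have "i \<cdot> (x \<star> y) \<star> x = i \<cdot> y"
    using mult_inverse_cancel[of "i \<cdot> y" "i \<cdot> x"] mult ty by (simp add: inverse_mult[OF co])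
  finally show "(\<theta> \<cdot> (\<phi> \<cdot> \<theta>)) \<cdot> \<langle>x, y\<rangle> = (\<phi> \<cdot> (\<theta> \<cdot> \<phi>)) \<cdot> \<langle>x, y\<rangle>"
    using 1 co by (simp del: \<theta>_pair \<phi>_pair)
qed (simp_all add: hom_iff)

lemma link_is_involutive: "(\<theta>, \<phi>, m) \<in> involutive_2_links C"
  using involutions braid
  by (auto simp: involutive_2_links_def hom_iff intro!: exI[of _ C2] exI[of _ C1])

lemma e1_e2:
  "\<pi>1 \<cdot> e1 = \<one> C1" "\<pi>2 \<cdot> e1 = e \<cdot> d" "m \<cdot> e1 = \<one> C1"
  "\<pi>1 \<cdot> e2 = e \<cdot> c" "\<pi>2 \<cdot> e2 = \<one> C1" "m \<cdot> e2 = \<one> C1"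
  by (simp_all add: e1_def e2_def units)

lemma \<theta>_e2: "\<theta> \<cdot> e2 = e2" and \<phi>_e1: "\<phi> \<cdot> e1 = e1"
  using comp_eq[OF inverse_unit] by (simp_all add: e1_def e2_def units)

lemma \<phi>_e2: "\<phi> \<cdot> e2 = \<langle>\<one> C1, i\<rangle>" and \<theta>_e1: "\<theta> \<cdot> e1 = \<langle>i, \<one> C1\<rangle>"
  by (simp_all add: e1_def e2_def units)

text \<open>By right cancellation x y and y determine x; the companion for \<open>\<pi>1\<close>
  uses left cancellation.\<close>

lemma jointly_monic_m_\<pi>2: "jointly_monic C m \<pi>2"
  unfolding jointly_monic_def
proof (intro conjI allI ballI impI)
  fix X h k
  assume hk: "h \<in> Hom C X (Dom C m)" "k \<in> Hom C X (Dom C m)"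
    and eq: "m \<cdot> h = m \<cdot> k \<and> \<pi>2 \<cdot> h = \<pi>2 \<cdot> k"
  then have ty: "h \<in> Arr C" "k \<in> Arr C" "Cod C h = C2" "Cod C k = C2"
    by (simp_all add: hom_iff)
  note co = composable_projections_comp[OF ty(1,3)] composable_projections_comp[OF ty(2,4)]
  have "\<pi>1 \<cdot> h \<star> \<pi>2 \<cdot> h = \<pi>1 \<cdot> k \<star> \<pi>2 \<cdot> h"
    using pair_projections[OF ty(1,3)] pair_projections[OF ty(2,4)] eq by metis
  then have "\<pi>1 \<cdot> h = \<pi>1 \<cdot> k"
    using co eq right_cancel[of "\<pi>1 \<cdot> h" "\<pi>2 \<cdot> h" "\<pi>1 \<cdot> k"] by metis
  then show "h = k"
    using hk eq pair_eqI[of h X k] by simp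
qed simp_all

lemma jointly_monic_m_\<pi>1: "jointly_monic C m \<pi>1"
  unfolding jointly_monic_def
proof (intro conjI allI ballI impI)
  fix X h k
  assume hk: "h \<in> Hom C X (Dom C m)" "k \<in> Hom C X (Dom C m)"
    and eq: "m \<cdot> h = m \<cdot> k \<and> \<pi>1 \<cdot> h = \<pi>1 \<cdot> k"
  then have ty: "h \<in> Arr C" "k \<in> Arr C" "Cod C h = C2" "Cod C k = C2"
    by (simp_all add: hom_iff)
  note co = composable_projections_comp[OF ty(1,3)] composable_projections_comp[OF ty(2,4)]
  have "\<pi>1 \<cdot> h \<star> \<pi>2 \<cdot> h = \<pi>1 \<cdot> h \<star> \<pi>2 \<cdot> k"
    using pair_projections[OF ty(1,3)] pair_projections[OF ty(2,4)] eq by metis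
  then have "\<pi>2 \<cdot> h = \<pi>2 \<cdot> k"
    using co eq left_cancel[of "\<pi>1 \<cdot> h" "\<pi>2 \<cdot> h" "\<pi>2 \<cdot> k"] by metis
  then show "h = k"
    using hk eq pair_eqI[of h X k] by simp
qed simp_all

text \<open>Since \<open>\<pi>2 \<cdot> e1 = e \<cdot> d\<close> and
  \<open>\<pi>1 \<cdot> e2 = e \<cdot> c\<close>, the last three equations of \<open>unital\<close>
  are the three boundary equations with \<open>e\<close> applied, and in the one before them both
  sides equal \<open>i\<close>.\<close>

lemma link_is_unital: "unital C (\<theta>, \<phi>, m)"
proof -
  note comp = comp_eq[OF m_\<theta>] comp_eq[OF m_\<phi>] comp_eq[OF e1_e2(1)] comp_eq[OF e1_e2(2)]
    comp_eq[OF e1_e2(4)] comp_eq[OF e1_e2(5)]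
  show ?thesis
    unfolding unital_def prod.case
  proof (intro conjI, goal_cases _ _ ex)
    case ex
    show ?case
      by (rule bexI[of _ e1], rule bexI[of _ e2])
        (simp_all add: hom_iff m_\<theta> m_\<phi> e1_e2 \<theta>_e2 \<phi>_e1 \<phi>_e2 \<theta>_e1 comp \<pi>_\<theta>_\<phi>
          composable_simps[of "\<one> C1", simplified])
  qed (simp_all only: m_\<theta> m_\<phi> jointly_monic_m_\<pi>1 jointly_monic_m_\<pi>2)
qed

text \<open>The degenerate pairs are sections of \<open>\<pi>1\<close> and \<open>\<pi>2\<close>,
  and \<open>e\<close> is a section of both \<open>d\<close> and \<open>c\<close>.\<close>

lemma boundary_pushout: "pushout_square C \<pi>1 \<pi>2 d c"
  by (rule split_pushout_square[of _ C2 C1 _ C1 _ C0 _ e1 e2 e e]) (simp_all add: hom_iff e1_e2)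

section \<open>Composable triples as overlapping pairs\<close>

context
  fixes q1 q2
  assumes triples: "pullback_square C q1 q2 (d \<cdot> \<pi>2) c"
begin

text \<open>A triple (x, y, z) is the same as pairs (x, y) and (y, z) sharing y; conversely it is
  recovered from the first pair and the last component of the second.\<close>

lemma triples_pullback: "pullback_square C q1 \<langle>\<pi>2 \<cdot> q1, q2\<rangle> \<pi>2 \<pi>1"
proof (rule pullback_squareI)
  note ty = triples_typing[OF triples] and co = triples_composable[OF triples]
  show "commutative_square C q1 \<langle>\<pi>2 \<cdot> q1, q2\<rangle> \<pi>2 \<pi>1"
    using ty co by (simp add: commutative_square_def)
next
  note ty = triples_typing[OF triples] and co = triples_composable[OF triples]
  fix X u v
  assume uv: "u \<in> Hom C X (Dom C \<pi>2)" "v \<in> Hom C X (Dom C \<pi>1)" "\<pi>2 \<cdot> u = \<pi>1 \<cdot> v"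
  then have tyuv: "u \<in> Arr C" "v \<in> Arr C" "Dom C u = X" "Dom C v = X" "Cod C u = C2" "Cod C v = C2"
    by (simp_all add: hom_iff)
  define h where "h = pairing C q1 q2 u (\<pi>2 \<cdot> v)"
  have h: "h \<in> Hom C X (Dom C q1)" "q1 \<cdot> h = u" "q2 \<cdot> h = \<pi>2 \<cdot> v"
    using pullback_pairing[OF triples, of u X "\<pi>2 \<cdot> v"] tyuv uv(3)
    by (auto simp: hom_iff h_def)
  have "\<langle>\<pi>2 \<cdot> q1, q2\<rangle> \<cdot> h = \<langle>\<pi>1 \<cdot> v, \<pi>2 \<cdot> v\<rangle>"
    using h co ty uv(3) by (simp add: hom_iff)
  also have "\<dots> = v"
    using tyuv by (simp add: pair_projections)
  finally show "\<exists>h. h \<in> Hom C X (Dom C q1) \<and> q1 \<cdot> h = u \<and> \<langle>\<pi>2 \<cdot> q1, q2\<rangle> \<cdot> h = v"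
    using h by blast
next
  note ty = triples_typing[OF triples] and co = triples_composable[OF triples]
  fix X h k
  assume hk: "h \<in> Hom C X (Dom C q1)" "k \<in> Hom C X (Dom C q1)" "q1 \<cdot> h = q1 \<cdot> k"
    "\<langle>\<pi>2 \<cdot> q1, q2\<rangle> \<cdot> h = \<langle>\<pi>2 \<cdot> q1, q2\<rangle> \<cdot> k"
  then have "\<pi>2 \<cdot> (\<langle>\<pi>2 \<cdot> q1, q2\<rangle> \<cdot> h) = \<pi>2 \<cdot> (\<langle>\<pi>2 \<cdot> q1, q2\<rangle> \<cdot> k)"
    by (simp only:)
  then have "q2 \<cdot> h = q2 \<cdot> k"
    using hk(1,2) ty co comp_eq[OF pair_simps(5)[OF co(2)]] by (simp add: hom_iff del: pair_comp)
  then show "h = k"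
    using pullback_eqI[OF triples hk(1,2,3)] by blast
qed

lemma triples_pushout: "pushout_square C q1 \<langle>\<pi>2 \<cdot> q1, q2\<rangle> \<pi>2 \<pi>1"
proof -
  note ty = triples_typing[OF triples] and co = triples_composable[OF triples]
  note comp = comp_eq[OF e1_e2(2)] comp_eq[OF e1_e2(5)]
  have e1_comp: "e1 \<cdot> k = \<langle>k, e \<cdot> (d \<cdot> k)\<rangle>" "e2 \<cdot> k = \<langle>e \<cdot> (c \<cdot> k), k\<rangle>"
    if "k \<in> Arr C" "Cod C k = C1" for k
    using that by (simp_all add: e1_def e2_def)
  \<comment> \<open>On elements this is (x, y) to (x, y, 1).\<close>
  define s where "s = pairing C q1 q2 (\<one> C2) (e \<cdot> (d \<cdot> \<pi>2))"
  have s: "s \<in> Hom C C2 (Dom C q1)" "q1 \<cdot> s = \<one> C2" "q2 \<cdot> s = e \<cdot> (d \<cdot> \<pi>2)"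
    using pullback_pairing[OF triples, of "\<one> C2" C2 "e \<cdot> (d \<cdot> \<pi>2)"]
    by (auto simp: hom_iff s_def)
  \<comment> \<open>On elements this is (y, z) to (1, y, z).\<close>
  define t where "t = pairing C q1 q2 (e2 \<cdot> \<pi>1) \<pi>2"
  have t: "t \<in> Hom C C2 (Dom C q1)" "q1 \<cdot> t = e2 \<cdot> \<pi>1" "q2 \<cdot> t = \<pi>2"
    using pullback_pairing[OF triples, of "e2 \<cdot> \<pi>1" C2 "\<pi>2"] comp
    by (auto simp: hom_iff t_def)
  show ?thesis
  proof (rule split_pushout_square[of _ "Dom C q1" C2 _ C2 _ C1 _ s t e1 e2])
    show "\<langle>\<pi>2 \<cdot> q1, q2\<rangle> \<cdot> s = e1 \<cdot> \<pi>2"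
      using s ty co by (simp add: hom_iff e1_comp)
    have "\<langle>\<pi>2 \<cdot> q1, q2\<rangle> \<cdot> t = \<langle>\<pi>2 \<cdot> (e2 \<cdot> \<pi>1), \<pi>2\<rangle>"
      using t ty co by (simp add: hom_iff)
    also have "\<dots> = \<one> C2"
      using comp(2)[of \<pi>1] pair_projections[of "\<one> C2"] by simp
    finally show "\<langle>\<pi>2 \<cdot> q1, q2\<rangle> \<cdot> t = \<one> C2" .
  qed (use s t ty co in \<open>simp_all add: hom_iff e1_e2\<close>)
qed

lemma link_is_associative: "associative C (\<theta>, \<phi>, m)"
proof -
  note ty = triples_typing[OF triples] and co = triples_composable[OF triples]
  let ?p2 = "\<langle>\<pi>2 \<cdot> q1, q2\<rangle>"
  have bi_exact: "bi_exact C \<pi>1 \<pi>2"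
    unfolding bi_exact_def
    using arrows(1,2) composable boundary_pushout triples_pullback triples_pushout by blast
  \<comment> \<open>The arrows \<open>m1\<close> and \<open>m2\<close> send (x, y, z) to (x y, z)
    and (x, y z), so \<open>m \<cdot> m1 = m \<cdot> m2\<close> is associativity at the generic
    triple.\<close>
  define m1 where "m1 = \<langle>m \<cdot> q1, q2\<rangle>"
  define m2 where "m2 = \<langle>\<pi>1 \<cdot> q1, \<pi>2 \<cdot> q1 \<star> q2\<rangle>"
  have "m1 \<in> Hom C (Dom C q1) (Dom C m)" "m2 \<in> Hom C (Dom C q1) (Dom C m)"
    using ty co by (simp_all add: hom_iff m1_def m2_def)
  moreover have "\<pi>1 \<cdot> m1 = m \<cdot> q1" "\<pi>2 \<cdot> m1 = \<pi>2 \<cdot> ?p2" "\<pi>1 \<cdot> m2 = \<pi>1 \<cdot> q1" "\<pi>2 \<cdot> m2 = m \<cdot> ?p2"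
    using ty co by (simp_all add: m1_def m2_def)
  moreover have "m \<cdot> m1 = m \<cdot> m2"
    using element_assoc[OF co(1,2)] ty by (simp add: m1_def m2_def pair_projections)
  ultimately show ?thesis
    unfolding associative_def Let_def prod.case m_\<theta> m_\<phi>
    using bi_exact triples_pullback triples_pushout by blast
qed

text \<open>Converse of \<open>internal_groupoid_laws\<close>, used for the groupoid built from a
  link: the laws missing from \<open>groupoid_data\<close> come from cancellation and from
  associativity at the generic triple.\<close>

lemma groupoid_is_internal: "internal_groupoid C C0 C1 C2 \<pi>1 \<pi>2 m d c e i"
proof
  note ty = triples_typing[OF triples] and co = triples_composable[OF triples]
  have "\<pi>1 \<cdot> q1 \<star> \<pi>2 \<cdot> q1 \<star> q2 = m \<cdot> q1 \<star> q2"
    using element_assoc[OF co(1,2)] ty by (simp add: pair_projections)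
  then show "\<exists>q1 q2. pullback_square C q1 q2 (d \<cdot> \<pi>2) c \<and>
      \<pi>1 \<cdot> q1 \<star> \<pi>2 \<cdot> q1 \<star> q2 = m \<cdot> q1 \<star> q2"
    using triples by blast
qed (simp_all add: arrows composable units inverses inverse_involutive inverse_unit)

end

end

lemma internal_groupoid_laws:
  assumes "internal_groupoid C C0 C1 C2 \<pi>1 \<pi>2 m d c e i"
  shows "groupoid_laws C C0 C1 C2 \<pi>1 \<pi>2 m d c e i"
proof -
  interpret internal_groupoid C C0 C1 C2 \<pi>1 \<pi>2 m d c e i by fact
  interpret groupoid_data C C0 C1 C2 \<pi>1 \<pi>2 m d c e i
    by unfold_locales (rule arrows reflexive boundary involution composable units inverses)+
  show ?thesis
    by unfold_locales (use associativity element_assoc_if_triple_assoc in blast)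
qed

section \<open>The groupoid of a unital associative link\<close>

text \<open>The witnesses hidden in \<open>unital\<close>, \<open>bi_exact\<close> and
  \<open>associative\<close> become parameters, with the equations nested to the right and
  \<open>m \<cdot> \<phi>\<close>, \<open>m \<cdot> \<theta>\<close> replaced by the
  projections.\<close>

locale unital_associative_link = category C
  for C :: "('o, 'a) cat" (structure) +
  fixes C0 C1 C2 :: 'o
    and \<theta> \<phi> m e1 e2 \<pi>1 \<pi>2 d c p1 p2 m1 m2 :: 'a
  assumes hom: "m \<in> Hom C C2 C1" "\<theta> \<in> Hom C C2 C2" "\<phi> \<in> Hom C C2 C2"
      "e1 \<in> Hom C C1 C2" "e2 \<in> Hom C C1 C2" "\<pi>1 \<in> Hom C C2 C1" "\<pi>2 \<in> Hom C C2 C1"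
      "d \<in> Hom C C1 C0" "c \<in> Hom C C1 C0"
    and projections: "\<pi>1 = m \<cdot> \<phi>" "\<pi>2 = m \<cdot> \<theta>"
    and involutions: "\<theta> \<cdot> \<theta> = \<one> C2" "\<phi> \<cdot> \<phi> = \<one> C2"
    and sections: "m \<cdot> e1 = \<one> C1" "m \<cdot> e2 = \<one> C1" "\<theta> \<cdot> e2 = e2" "\<phi> \<cdot> e1 = e1"
    and inverse: "\<pi>2 \<cdot> (\<phi> \<cdot> e2) = \<pi>1 \<cdot> (\<theta> \<cdot> e1)"
    and identities: "\<pi>2 \<cdot> (e1 \<cdot> \<pi>1) = \<pi>1 \<cdot> (e2 \<cdot> \<pi>2)"
      "\<pi>2 \<cdot> (e1 \<cdot> m) = \<pi>2 \<cdot> (e1 \<cdot> \<pi>2)" "\<pi>1 \<cdot> (e2 \<cdot> m) = \<pi>1 \<cdot> (e2 \<cdot> \<pi>1)"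
    and pullback: "pullback_square C \<pi>1 \<pi>2 d c"
    and pushout: "pushout_square C \<pi>1 \<pi>2 d c"
    and triples: "pullback_square C p1 p2 \<pi>2 \<pi>1"
    and triple_mult: "m1 \<in> Hom C (Dom C p1) C2" "m2 \<in> Hom C (Dom C p1) C2"
      "\<pi>1 \<cdot> m1 = m \<cdot> p1" "\<pi>2 \<cdot> m1 = \<pi>2 \<cdot> p2" "\<pi>1 \<cdot> m2 = \<pi>1 \<cdot> p1" "\<pi>2 \<cdot> m2 = m \<cdot> p2"
      "m \<cdot> m1 = m \<cdot> m2"
begin

lemma link_typing [simp]:
  "m \<in> Arr C" "\<theta> \<in> Arr C" "\<phi> \<in> Arr C" "e1 \<in> Arr C" "e2 \<in> Arr C" "\<pi>1 \<in> Arr C" "\<pi>2 \<in> Arr C"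
  "d \<in> Arr C" "c \<in> Arr C" "m1 \<in> Arr C" "m2 \<in> Arr C"
  "Dom C m = C2" "Dom C \<theta> = C2" "Dom C \<phi> = C2" "Dom C e1 = C1" "Dom C e2 = C1"
  "Dom C \<pi>1 = C2" "Dom C \<pi>2 = C2" "Dom C d = C1" "Dom C c = C1"
  "Dom C m1 = Dom C p1" "Dom C m2 = Dom C p1"
  "Cod C m = C1" "Cod C \<theta> = C2" "Cod C \<phi> = C2" "Cod C e1 = C2" "Cod C e2 = C2"
  "Cod C \<pi>1 = C1" "Cod C \<pi>2 = C1" "Cod C d = C0" "Cod C c = C0" "Cod C m1 = C2" "Cod C m2 = C2"
  using hom triple_mult(1,2) by (simp_all add: hom_iff)

lemma link_objects [simp]: "C0 \<in> Obj C" "C1 \<in> Obj C" "C2 \<in> Obj C"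
  using cod_obj[of d] dom_obj[of d] dom_obj[of m] by simp_all

lemma link_triples_typing [simp]:
  "p1 \<in> Arr C" "p2 \<in> Arr C" "Dom C p2 = Dom C p1" "Cod C p1 = C2" "Cod C p2 = C2"
  "\<pi>2 \<cdot> p1 = \<pi>1 \<cdot> p2"
  using triples by (auto simp: pullback_square_def commutative_square_def)

lemma d_\<pi>1: "d \<cdot> \<pi>1 = c \<cdot> \<pi>2"
  using pullback by (simp add: pullback_square_def commutative_square_def)

lemma m_\<theta>_\<phi>: "m \<cdot> \<theta> = \<pi>2" "m \<cdot> \<phi> = \<pi>1"
  using projections by simp_all

lemma \<pi>_\<theta>_\<phi>: "\<pi>2 \<cdot> \<theta> = m" "\<pi>1 \<cdot> \<phi> = m"
  by (simp_all add: projections involutions)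

lemma \<pi>_e: "\<pi>1 \<cdot> e1 = \<one> C1" "\<pi>2 \<cdot> e2 = \<one> C1"
  by (simp_all add: projections sections)

text \<open>The prescribed composites are compatible with the square by the first of the
  \<open>identities\<close>, so the pushout property supplies this arrow.\<close>

definition e where "e = (THE h. h \<in> Hom C C0 C1 \<and> h \<cdot> d = \<pi>2 \<cdot> e1 \<and> h \<cdot> c = \<pi>1 \<cdot> e2)"
text \<open>In a groupoid \<open>\<phi>\<close> sends (1, x) to (x, x^-1), and \<open>\<pi>2\<close>
  extracts the inverse.\<close>

definition i where "i = \<pi>2 \<cdot> (\<phi> \<cdot> e2)"

lemma e: "e \<in> Hom C C0 C1" "e \<cdot> d = \<pi>2 \<cdot> e1" "e \<cdot> c = \<pi>1 \<cdot> e2"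
proof -
  have "\<pi>2 \<cdot> e1 \<in> Hom C (Cod C \<pi>1) C1" "\<pi>1 \<cdot> e2 \<in> Hom C (Cod C \<pi>2) C1"
    by (simp_all add: hom_iff)
  moreover have "(\<pi>2 \<cdot> e1) \<cdot> \<pi>1 = (\<pi>1 \<cdot> e2) \<cdot> \<pi>2"
    using identities(1) by simp
  ultimately have "\<exists>!h. h \<in> Hom C (Cod C d) C1 \<and> h \<cdot> d = \<pi>2 \<cdot> e1 \<and> h \<cdot> c = \<pi>1 \<cdot> e2"
    using pushout by (simp only: pushout_square_def)
  then have "\<exists>!h. h \<in> Hom C C0 C1 \<and> h \<cdot> d = \<pi>2 \<cdot> e1 \<and> h \<cdot> c = \<pi>1 \<cdot> e2"
    by simp
  from theI'[OF this] show "e \<in> Hom C C0 C1" "e \<cdot> d = \<pi>2 \<cdot> e1" "e \<cdot> c = \<pi>1 \<cdot> e2"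
    by (simp_all only: e_def)
qed

lemma e_ty [simp]: "e \<in> Arr C" "Dom C e = C0" "Cod C e = C1"
  using e by (simp_all add: hom_iff)

lemma i_ty [simp]: "i \<in> Arr C" "Dom C i = C1" "Cod C i = C1"
  by (simp_all add: i_def)

text \<open>Apply the square to \<open>e1\<close> and \<open>e2\<close>: for instance c e d = c
  \<open>\<pi>2\<close> \<open>e1\<close> = d \<open>\<pi>1\<close> \<open>e1\<close> = d.\<close>

lemma c_e_d: "c \<cdot> (e \<cdot> d) = d" and d_e_c: "d \<cdot> (e \<cdot> c) = c"
proof -
  have "c \<cdot> (\<pi>2 \<cdot> e1) = d \<cdot> (\<pi>1 \<cdot> e1)" "d \<cdot> (\<pi>1 \<cdot> e2) = c \<cdot> (\<pi>2 \<cdot> e2)"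
    by (rule comp_eq_comp; simp add: d_\<pi>1)+
  then show "c \<cdot> (e \<cdot> d) = d" "d \<cdot> (e \<cdot> c) = c"
    by (simp_all add: e \<pi>_e)
qed

text \<open>The remaining \<open>identities\<close> say that \<open>e\<close> equalizes the desired
  equations: e d m = e d \<open>\<pi>2\<close> and e c m = e c \<open>\<pi>1\<close>. Applying
  \<open>c\<close> to the first and \<open>d\<close> to the second removes \<open>e\<close>, by the
  preceding lemma.\<close>

lemma boundary_m: "d \<cdot> m = d \<cdot> \<pi>2" "c \<cdot> m = c \<cdot> \<pi>1"
proof -
  have *: "c \<cdot> (\<pi>2 \<cdot> (e1 \<cdot> k)) = d \<cdot> k" "d \<cdot> (\<pi>1 \<cdot> (e2 \<cdot> k)) = c \<cdot> k"
    if "k \<in> Arr C" "Cod C k = C1" for k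
    using that comp_eq[OF c_e_d, of k] comp_eq[OF d_e_c, of k] by (simp_all add: e)
  show "d \<cdot> m = d \<cdot> \<pi>2" "c \<cdot> m = c \<cdot> \<pi>1"
    using *[of m] *[of \<pi>1] *[of \<pi>2] by (simp_all add: identities)
qed

text \<open>Arrows out of the pushout \<open>C0\<close> are determined by their composites with
  \<open>d\<close> and \<open>c\<close>. Two of these composites are in \<open>c_e_d\<close> and
  \<open>d_e_c\<close>; the other two come from evaluating \<open>boundary_m\<close> at the sections
  \<open>e1\<close> and \<open>e2\<close>.\<close>

lemma reflexive: "d \<cdot> e = \<one> C0" "c \<cdot> e = \<one> C0"
proof -
  have d_e_d: "d \<cdot> (e \<cdot> d) = d"
    using comp_eq_comp[OF boundary_m(1)[symmetric], of e1] by (simp add: e sections)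
  have c_e_c: "c \<cdot> (e \<cdot> c) = c"
    using comp_eq_comp[OF boundary_m(2)[symmetric], of e2] by (simp add: e sections)
  show "d \<cdot> e = \<one> C0" "c \<cdot> e = \<one> C0"
    by (rule pushout_eqI[OF pushout, of _ C0]; simp add: hom_iff d_e_d c_e_c c_e_d d_e_c)+
qed

text \<open>Each half uses one of the two descriptions of \<open>i\<close> provided by
  \<open>inverse\<close>: as first component of \<open>\<theta> \<cdot> e1\<close>, and as second
  component of \<open>\<phi> \<cdot> e2\<close>. The other component is the identity in both
  cases.\<close>

lemma reversal: "d \<cdot> i = c" "c \<cdot> i = d"
proof -
  have "d \<cdot> (\<pi>1 \<cdot> (\<theta> \<cdot> e1)) = c \<cdot> (\<pi>2 \<cdot> (\<theta> \<cdot> e1))"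
      "c \<cdot> (\<pi>2 \<cdot> (\<phi> \<cdot> e2)) = d \<cdot> (\<pi>1 \<cdot> (\<phi> \<cdot> e2))"
    by (rule comp_eq_comp; simp add: d_\<pi>1)+
  moreover have "\<pi>2 \<cdot> (\<theta> \<cdot> e1) = \<one> C1" "\<pi>1 \<cdot> (\<phi> \<cdot> e2) = \<one> C1"
    using comp_eq[OF \<pi>_\<theta>_\<phi>(1), of e1] comp_eq[OF \<pi>_\<theta>_\<phi>(2), of e2] by (simp_all add: sections)
  ultimately show "d \<cdot> i = c" "c \<cdot> i = d"
    by (simp_all add: i_def inverse)
qed

lemma sections_eq_pairing:
  "pairing C \<pi>1 \<pi>2 (\<one> C1) (e \<cdot> d) = e1" "pairing C \<pi>1 \<pi>2 (e \<cdot> c) (\<one> C1) = e2"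
  by (rule pairing_eqI[OF pullback, of _ C1]; simp add: hom_iff e \<pi>_e)+

lemma inverses_eq_pairing:
  "pairing C \<pi>1 \<pi>2 (\<one> C1) i = \<phi> \<cdot> e2" "pairing C \<pi>1 \<pi>2 i (\<one> C1) = \<theta> \<cdot> e1"
  using comp_eq[OF \<pi>_\<theta>_\<phi>(1), of e1] comp_eq[OF \<pi>_\<theta>_\<phi>(2), of e2]
  by (intro pairing_eqI[OF pullback, of _ C1]; simp add: hom_iff i_def sections flip: inverse)+

text \<open>The unit laws are the equations m \<open>e1\<close> = 1 = m \<open>e2\<close>. The
  inverse laws are m \<open>\<phi>\<close> \<open>e2\<close> = \<open>\<pi>1\<close>
  \<open>e2\<close> = e c and m \<open>\<theta>\<close> \<open>e1\<close> = \<open>\<pi>2\<close>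
  \<open>e1\<close> = e d.\<close>

sublocale groupoid_data C C0 C1 C2 \<pi>1 \<pi>2 m d c e i
  by unfold_locales
    (use comp_eq[OF m_\<theta>_\<phi>(1), of e1] comp_eq[OF m_\<theta>_\<phi>(2), of e2] in
      \<open>simp_all add: hom_iff reflexive boundary_m d_\<pi>1 reversal pullback sections_eq_pairing
        inverses_eq_pairing sections flip: e(2,3)\<close>)

sublocale laws: groupoid_laws C C0 C1 C2 \<pi>1 \<pi>2 m d c e i
proof
  fix x y z assume co: "composable_elements x y" "composable_elements y z"
  note co_ty = composableE[OF co(1)] composableE[OF co(2)]
  \<comment> \<open>The overlapping pairs (x, y) and (y, z) define an element of the pullback, where
    \<open>m1\<close> and \<open>m2\<close> take the values (x y, z) and (x, y z).\<close>
  define h where "h = pairing C p1 p2 \<langle>x, y\<rangle> \<langle>y, z\<rangle>"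
  have h: "h \<in> Arr C" "Dom C h = Dom C x" "Cod C h = Dom C p1"
      "p1 \<cdot> h = \<langle>x, y\<rangle>" "p2 \<cdot> h = \<langle>y, z\<rangle>"
    using pullback_pairing[OF triples, of "\<langle>x, y\<rangle>" "Dom C x" "\<langle>y, z\<rangle>"] co co_ty
    by (auto simp: hom_iff h_def)
  have m1: "m1 \<cdot> h = \<langle>x \<star> y, z\<rangle>"
    by (rule pair_eqI[of _ "Dom C x"])
      (use h co co_ty composable_mult(1)[OF co] comp_eq_comp[OF triple_mult(3), of h]
        comp_eq_comp[OF triple_mult(4), of h] in \<open>simp_all add: hom_iff\<close>)
  have m2: "m2 \<cdot> h = \<langle>x, y \<star> z\<rangle>"
    by (rule pair_eqI[of _ "Dom C x"])
      (use h co co_ty composable_mult(2)[OF co(2,1)] comp_eq_comp[OF triple_mult(5), of h]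
        comp_eq_comp[OF triple_mult(6), of h] in \<open>simp_all add: hom_iff\<close>)
  show "(x \<star> y) \<star> z = x \<star> y \<star> z"
    using comp_eq_comp[OF triple_mult(7), of h] h by (simp add: m1 m2)
qed

text \<open>The translation opposite to \<open>triples_pullback\<close>: the same object serves as
  the object of triples, with third component read off from the second pair. The shared middle
  component makes the second pair recoverable.\<close>

lemma composable_triples: "pullback_square C p1 (\<pi>2 \<cdot> p2) (d \<cdot> \<pi>2) c"
proof (rule pullback_squareI)
  show "commutative_square C p1 (\<pi>2 \<cdot> p2) (d \<cdot> \<pi>2) c"
    by (simp add: commutative_square_def)
next
  fix X u v
  assume uv: "u \<in> Hom C X (Dom C (d \<cdot> \<pi>2))" "v \<in> Hom C X (Dom C c)" "(d \<cdot> \<pi>2) \<cdot> u = c \<cdot> v"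
  then have tyuv: "u \<in> Arr C" "v \<in> Arr C" "Dom C u = X" "Dom C v = X" "Cod C u = C2" "Cod C v = C1"
    by (simp_all add: hom_iff)
  then have co: "composable_elements (\<pi>2 \<cdot> u) v"
    using uv(3) by (simp add: composable_elements_def)
  define h where "h = pairing C p1 p2 u \<langle>\<pi>2 \<cdot> u, v\<rangle>"
  have h: "h \<in> Hom C X (Dom C p1)" "p1 \<cdot> h = u" "p2 \<cdot> h = \<langle>\<pi>2 \<cdot> u, v\<rangle>"
    using pullback_pairing[OF triples, of u X "\<langle>\<pi>2 \<cdot> u, v\<rangle>"] tyuv co
    by (auto simp: hom_iff h_def)
  then have "(\<pi>2 \<cdot> p2) \<cdot> h = v"
    using co by (simp add: hom_iff)
  then show "\<exists>h. h \<in> Hom C X (Dom C p1) \<and> p1 \<cdot> h = u \<and> (\<pi>2 \<cdot> p2) \<cdot> h = v"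
    using h by blast
next
  fix X h k
  assume hk: "h \<in> Hom C X (Dom C p1)" "k \<in> Hom C X (Dom C p1)" "p1 \<cdot> h = p1 \<cdot> k"
    "(\<pi>2 \<cdot> p2) \<cdot> h = (\<pi>2 \<cdot> p2) \<cdot> k"
  have "p2 \<cdot> h = p2 \<cdot> k"
  proof (rule pair_eqI)
    show "p2 \<cdot> h \<in> Hom C X C2" "p2 \<cdot> k \<in> Hom C X C2"
      using hk by (simp_all add: hom_iff)
    show "\<pi>2 \<cdot> (p2 \<cdot> h) = \<pi>2 \<cdot> (p2 \<cdot> k)"
      using hk by (simp add: hom_iff)
    have "\<pi>1 \<cdot> (p2 \<cdot> l) = \<pi>2 \<cdot> (p1 \<cdot> l)" if "l \<in> Hom C X (Dom C p1)" for l
      using that by (intro comp_eq_comp) (simp_all add: hom_iff)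
    then show "\<pi>1 \<cdot> (p2 \<cdot> h) = \<pi>1 \<cdot> (p2 \<cdot> k)"
      using hk(1-3) by simp
  qed
  then show "h = k"
    using pullback_eqI[OF triples hk(1,2,3)] by blast
qed

lemmas is_internal_groupoid = laws.groupoid_is_internal[OF composable_triples]

section \<open>Recovering the link from its groupoid\<close>

lemma m_eq: "m = \<pi>1 \<star> \<pi>2"
  using pair_projections[of "\<one> C2"] by simp

text \<open>By \<open>m \<cdot> \<theta> = \<pi>2\<close> and
  \<open>\<pi>2 \<cdot> \<theta> = m\<close>, the first component w of \<open>\<theta>\<close> at
  (x, y) satisfies w (x y) = y, as x^-1 does. The formula for \<open>\<phi>\<close> follows
  symmetrically by left cancellation.\<close>

lemma \<theta>_eq: "\<theta> = \<langle>i \<cdot> \<pi>1, m\<rangle>"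
proof -
  have pair: "\<langle>\<pi>1 \<cdot> \<theta>, m\<rangle> = \<theta>"
    using pair_projections[of \<theta>] by (simp add: \<pi>_\<theta>_\<phi>)
  have "\<pi>1 \<cdot> \<theta> = i \<cdot> \<pi>1"
  proof (rule laws.right_cancel)
    show "composable_elements (\<pi>1 \<cdot> \<theta>) m"
      using composable_projections_comp[of \<theta>] by (simp add: \<pi>_\<theta>_\<phi>)
    show "composable_elements (i \<cdot> \<pi>1) m"
      by (rule laws.link_composable)
    have "i \<cdot> \<pi>1 \<star> m = \<pi>2"
      using laws.inverse_mult_cancel[OF composable_projections] m_eq by simp
    then show "\<pi>1 \<cdot> \<theta> \<star> m = i \<cdot> \<pi>1 \<star> m"
      by (simp add: pair m_\<theta>_\<phi>)
  qed
  with pair show ?thesis by simp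
qed

lemma \<phi>_eq: "\<phi> = \<langle>m, i \<cdot> \<pi>2\<rangle>"
proof -
  have pair: "\<langle>m, \<pi>2 \<cdot> \<phi>\<rangle> = \<phi>"
    using pair_projections[of \<phi>] by (simp add: \<pi>_\<theta>_\<phi>)
  have "\<pi>2 \<cdot> \<phi> = i \<cdot> \<pi>2"
  proof (rule laws.left_cancel)
    show "composable_elements m (\<pi>2 \<cdot> \<phi>)"
      using composable_projections_comp[of \<phi>] by (simp add: \<pi>_\<theta>_\<phi>)
    show "composable_elements m (i \<cdot> \<pi>2)"
      by (rule laws.link_composable)
    have "m \<star> i \<cdot> \<pi>2 = \<pi>1"
      using laws.mult_inverse_cancel[OF composable_projections] m_eq by simp
    then show "m \<star> \<pi>2 \<cdot> \<phi> = m \<star> i \<cdot> \<pi>2"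
      by (simp add: pair m_\<theta>_\<phi>)
  qed
  with pair show ?thesis by simp
qed

end

fun groupoid_link :: "('o, 'a) cat \<Rightarrow> ('o, 'a) igpd \<Rightarrow> 'a link" where
  "groupoid_link C (C0, C1, C2, \<pi>1, \<pi>2, m, d, c, e, i) =
    (pairing C \<pi>1 \<pi>2 (i \<cdot>\<^bsub>C\<^esub> \<pi>1) m, pairing C \<pi>1 \<pi>2 m (i \<cdot>\<^bsub>C\<^esub> \<pi>2), m)"

lemma (in category) groupoid_link_surjective:
  assumes "L \<in> involutive_2_links C" "unital C L" "associative C L"
  shows "L \<in> groupoid_link C ` internal_groupoids C"
proof -
  obtain \<theta> \<phi> m where L: "L = (\<theta>, \<phi>, m)"
    by (cases L) auto
  define \<pi>1 \<pi>2 where "\<pi>1 = m \<cdot> \<phi>" "\<pi>2 = m \<cdot> \<theta>"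
  obtain C2 C1 where link: "m \<in> Hom C C2 C1" "\<theta> \<in> Hom C C2 C2" "\<phi> \<in> Hom C C2 C2"
      "\<theta> \<cdot> \<theta> = \<one> C2" "\<phi> \<cdot> \<phi> = \<one> C2"
    using assms(1) unfolding L involutive_2_links_def by auto
  have ty: "m \<in> Arr C" "\<theta> \<in> Arr C" "\<phi> \<in> Arr C" "Dom C m = C2" "Dom C \<theta> = C2" "Dom C \<phi> = C2"
      "Cod C m = C1" "Cod C \<theta> = C2" "Cod C \<phi> = C2"
    using link by (simp_all add: hom_iff)
  have \<pi>: "\<pi>1 \<in> Hom C C2 C1" "\<pi>2 \<in> Hom C C2 C1"
    using ty by (simp_all add: hom_iff \<pi>1_\<pi>2_def)
  obtain e1 e2 where e: "e1 \<in> Hom C C1 C2" "e2 \<in> Hom C C1 C2"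
    and eqs: "m \<cdot> e1 = \<one> C1" "m \<cdot> e2 = \<one> C1" "\<theta> \<cdot> e2 = e2" "\<phi> \<cdot> e1 = e1"
      "\<pi>2 \<cdot> \<phi> \<cdot> e2 = \<pi>1 \<cdot> \<theta> \<cdot> e1"
      "\<pi>2 \<cdot> e1 \<cdot> m \<cdot> \<phi> = \<pi>1 \<cdot> e2 \<cdot> m \<cdot> \<theta>"
      "\<pi>2 \<cdot> e1 \<cdot> m = \<pi>2 \<cdot> e1 \<cdot> m \<cdot> \<theta>" "\<pi>1 \<cdot> e2 \<cdot> m = \<pi>1 \<cdot> e2 \<cdot> m \<cdot> \<phi>"
    using assms(2) ty unfolding L unital_def \<pi>1_\<pi>2_def by auto
  obtain d c where dc: "pullback_square C \<pi>1 \<pi>2 d c" "pushout_square C \<pi>1 \<pi>2 d c"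
    using assms(3) unfolding L associative_def bi_exact_def \<pi>1_\<pi>2_def by (auto simp: Let_def)
  obtain p1 p2 m1 m2 where p: "pullback_square C p1 p2 \<pi>2 \<pi>1"
      "m1 \<in> Hom C (Dom C p1) C2" "m2 \<in> Hom C (Dom C p1) C2"
      "\<pi>1 \<cdot> m1 = m \<cdot> p1" "\<pi>2 \<cdot> m1 = \<pi>2 \<cdot> p2" "\<pi>1 \<cdot> m2 = \<pi>1 \<cdot> p1" "\<pi>2 \<cdot> m2 = m \<cdot> p2"
      "m \<cdot> m1 = m \<cdot> m2"
    using assms(3) ty(4) unfolding L associative_def \<pi>1_\<pi>2_def by (auto simp: Let_def)
  obtain C0 where "d \<in> Hom C C1 C0" "c \<in> Hom C C1 C0"
    using dc(1) \<pi> by (auto simp: pullback_square_def commutative_square_def hom_iff)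
  note all = this link \<pi> e dc p eqs(1-4)
  have right_assoc: "\<pi>2 \<cdot> (\<phi> \<cdot> e2) = \<pi>1 \<cdot> (\<theta> \<cdot> e1)" "\<pi>2 \<cdot> (e1 \<cdot> \<pi>1) = \<pi>1 \<cdot> (e2 \<cdot> \<pi>2)"
      "\<pi>2 \<cdot> (e1 \<cdot> m) = \<pi>2 \<cdot> (e1 \<cdot> \<pi>2)" "\<pi>1 \<cdot> (e2 \<cdot> m) = \<pi>1 \<cdot> (e2 \<cdot> \<pi>1)"
    using eqs(5-8) ty e[unfolded hom_iff] unfolding \<pi>1_\<pi>2_def by simp_all
  have "unital_associative_link C C0 C1 C2 \<theta> \<phi> m e1 e2 \<pi>1 \<pi>2 d c p1 p2 m1 m2"
    by (unfold_locales; rule all right_assoc \<pi>1_\<pi>2_def)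
  then interpret unital_associative_link C C0 C1 C2 \<theta> \<phi> m e1 e2 \<pi>1 \<pi>2 d c p1 p2 m1 m2 .
  have "L = groupoid_link C (C0, C1, C2, \<pi>1, \<pi>2, m, d, c, e, i)"
    using \<theta>_eq \<phi>_eq by (simp add: L)
  moreover have "(C0, C1, C2, \<pi>1, \<pi>2, m, d, c, e, i) \<in> internal_groupoids C"
    using is_internal_groupoid by (simp add: internal_groupoids_def)
  ultimately show ?thesis
    by (rule image_eqI)
qed

section \<open>Morphisms\<close>

locale groupoid_pair =
  G: groupoid_laws C C0 C1 C2 \<pi>1 \<pi>2 m d c e i +
  G': groupoid_laws C C0' C1' C2' \<pi>1' \<pi>2' m' d' c' e' i'
  for C :: "('o, 'a) cat" (structure)
    and C0 C1 C2 \<pi>1 \<pi>2 m d c e i C0' C1' C2' \<pi>1' \<pi>2' m' d' c' e' i'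
begin

lemma link_hom_if_groupoid_hom:
  assumes hom: "f0 \<in> Hom C C0 C0'" "f1 \<in> Hom C C1 C1'" "f2 \<in> Hom C C2 C2'"
    and preserves: "\<pi>1' \<cdot> f2 = f1 \<cdot> \<pi>1" "\<pi>2' \<cdot> f2 = f1 \<cdot> \<pi>2" "m' \<cdot> f2 = f1 \<cdot> m" "i' \<cdot> f1 = f1 \<cdot> i"
  shows "f2 \<cdot> G.\<theta> = G'.\<theta> \<cdot> f2" "f2 \<cdot> G.\<phi> = G'.\<phi> \<cdot> f2"
proof -
  have ty: "f1 \<in> Arr C" "f2 \<in> Arr C" "Dom C f1 = C1" "Dom C f2 = C2" "Cod C f1 = C1'" "Cod C f2 = C2'"
    using hom by (simp_all add: G.hom_iff)
  note comp = G.comp_eq_comp[OF preserves(1)] G.comp_eq_comp[OF preserves(2)]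
    G.comp_eq_comp[OF preserves(4)] G.comp_eq[OF G'.\<pi>_\<theta>_\<phi>(1)] G.comp_eq[OF G'.\<pi>_\<theta>_\<phi>(2)]
    G.comp_eq[OF G'.\<pi>_\<theta>_\<phi>(3)] G.comp_eq[OF G'.\<pi>_\<theta>_\<phi>(4)]
  show "f2 \<cdot> G.\<theta> = G'.\<theta> \<cdot> f2" "f2 \<cdot> G.\<phi> = G'.\<phi> \<cdot> f2"
    by (rule G'.pair_eqI[of _ C2]; simp add: G.hom_iff ty comp preserves G.\<pi>_\<theta>_\<phi>)+
qed

section \<open>Morphisms of links preserve the groupoid structure\<close>

context
  fixes f g
  assumes hom: "f \<in> Hom C C2 C2'" "g \<in> Hom C C1 C1'"
    and preserves: "f \<cdot> G.\<theta> = G'.\<theta> \<cdot> f" "f \<cdot> G.\<phi> = G'.\<phi> \<cdot> f" "m' \<cdot> f = g \<cdot> m"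
begin

lemma hom_typing:
  "f \<in> Arr C" "g \<in> Arr C" "Dom C f = C2" "Dom C g = C1" "Cod C f = C2'" "Cod C g = C1'"
  using hom by (simp_all add: G.hom_iff)

lemma preserves_projections: "\<pi>1' \<cdot> f = g \<cdot> \<pi>1" "\<pi>2' \<cdot> f = g \<cdot> \<pi>2"
proof -
  note ty = hom_typing
  have "\<pi>1' \<cdot> f = m' \<cdot> (f \<cdot> G.\<phi>)" "\<pi>2' \<cdot> f = m' \<cdot> (f \<cdot> G.\<theta>)"
    using ty G.comp_eq[OF G'.m_\<phi>, of f] G.comp_eq[OF G'.m_\<theta>, of f] by (simp_all add: preserves)
  then show "\<pi>1' \<cdot> f = g \<cdot> \<pi>1" "\<pi>2' \<cdot> f = g \<cdot> \<pi>2"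
    using ty G.comp_eq_comp[OF preserves(3), of G.\<phi>] G.comp_eq_comp[OF preserves(3), of G.\<theta>]
    by (simp_all add: G.m_\<phi> G.m_\<theta>)
qed

text \<open>By \<open>preserves_projections\<close>, \<open>f\<close> acts on pairs as (x, y) to (g
  x, g y).\<close>

lemma preserves_mult:
  assumes "G.composable_elements x y"
  shows "G'.composable_elements (g \<cdot> x) (g \<cdot> y)"
    "m' \<cdot> pairing C \<pi>1' \<pi>2' (g \<cdot> x) (g \<cdot> y) = g \<cdot> (m \<cdot> pairing C \<pi>1 \<pi>2 x y)"
proof -
  note ty = hom_typing
  let ?k = "pairing C \<pi>1 \<pi>2 x y"
  have "\<pi>1' \<cdot> (f \<cdot> ?k) = g \<cdot> (\<pi>1 \<cdot> ?k)" "\<pi>2' \<cdot> (f \<cdot> ?k) = g \<cdot> (\<pi>2 \<cdot> ?k)"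
    "m' \<cdot> (f \<cdot> ?k) = g \<cdot> (m \<cdot> ?k)"
    using ty assms
    by (simp_all add: G.comp_eq_comp[OF preserves_projections(1)]
        G.comp_eq_comp[OF preserves_projections(2)] G.comp_eq_comp[OF preserves(3)])
  then show "G'.composable_elements (g \<cdot> x) (g \<cdot> y)"
    "m' \<cdot> pairing C \<pi>1' \<pi>2' (g \<cdot> x) (g \<cdot> y) = g \<cdot> (m \<cdot> ?k)"
    using ty assms G'.composable_projections_comp[of "f \<cdot> ?k"] G'.pair_projections[of "f \<cdot> ?k"]
    by simp_all
qed

text \<open>Apply \<open>g\<close> to x 1 = x and cancel g x on the left; for the other unit cancel
  on the right.\<close>

lemma preserves_units: "g \<cdot> (e \<cdot> d) = e' \<cdot> (d' \<cdot> g)" "g \<cdot> (e \<cdot> c) = e' \<cdot> (c' \<cdot> g)"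
proof -
  note ty = hom_typing
  show "g \<cdot> (e \<cdot> d) = e' \<cdot> (d' \<cdot> g)"
    by (rule G'.left_cancel[of g])
      (use ty preserves_mult[OF G.link_composable(3)] in \<open>simp_all add: G.units G'.unit_right\<close>)
  show "g \<cdot> (e \<cdot> c) = e' \<cdot> (c' \<cdot> g)"
    by (rule G'.right_cancel[of _ g])
      (use ty preserves_mult[OF G.link_composable(4)] in \<open>simp_all add: G.units G'.unit_left\<close>)
qed

lemma preserves_inverse: "i' \<cdot> g = g \<cdot> i"
proof -
  note ty = hom_typing
  have "G.composable_elements (\<one> C1) i"
    by (simp add: G.composable_elements_def)
  note mult = preserves_mult[OF this]
  show ?thesis
    by (rule G'.left_cancel[of g])
      (use ty mult in \<open>simp_all add: G.inverses G'.inverse_right preserves_units\<close>)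
qed

text \<open>These are the conditions on \<open>d' \<cdot> (g \<cdot> e)\<close> as the component on
  objects. Moving \<open>g\<close> past \<open>e \<cdot> d\<close> or \<open>e \<cdot> c\<close> by
  \<open>preserves_units\<close> leaves \<open>d' \<cdot> e'\<close>, which is an identity.\<close>

lemma preserves_boundary:
  "d' \<cdot> g = (d' \<cdot> (g \<cdot> e)) \<cdot> d" "c' \<cdot> g = (d' \<cdot> (g \<cdot> e)) \<cdot> c" "e' \<cdot> (d' \<cdot> (g \<cdot> e)) = g \<cdot> e"
  using hom_typing preserves_units G.comp_eq_comp[OF preserves_units(1)[symmetric], of e]
  by simp_all

end

end

section \<open>The functor from groupoids to links\<close>

fun groupoid_link_map ::
  "('o, 'a) cat \<Rightarrow> ('o, 'a) igpd \<times> ('a \<times> 'a \<times> 'a) \<times> ('o, 'a) igpd \<Rightarrow>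
    'a link \<times> ('a \<times> 'a) \<times> 'a link" where
  "groupoid_link_map C (x, (f0, f1, f2), y) = (groupoid_link C x, (f2, f1), groupoid_link C y)"

context category
begin

lemma groupoid_link_homs:
  assumes "x \<in> internal_groupoids C" "y \<in> internal_groupoids C"
  shows "bij_betw (\<lambda>(f0, f1, f2). (f2, f1)) (groupoid_homs C x y)
    (link_homs C (groupoid_link C x) (groupoid_link C y))"
proof -
  obtain C0 C1 C2 \<pi>1 \<pi>2 m d c e i where x: "x = (C0, C1, C2, \<pi>1, \<pi>2, m, d, c, e, i)"
    by (metis prod.exhaust)
  obtain C0' C1' C2' \<pi>1' \<pi>2' m' d' c' e' i'
    where y: "y = (C0', C1', C2', \<pi>1', \<pi>2', m', d', c', e', i')"
    by (metis prod.exhaust)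
  interpret G: groupoid_laws C C0 C1 C2 \<pi>1 \<pi>2 m d c e i
    using assms(1) by (intro internal_groupoid_laws) (simp add: x internal_groupoids_def)
  interpret G': groupoid_laws C C0' C1' C2' \<pi>1' \<pi>2' m' d' c' e' i'
    using assms(2) by (intro internal_groupoid_laws) (simp add: y internal_groupoids_def)
  interpret groupoid_pair C C0 C1 C2 \<pi>1 \<pi>2 m d c e i C0' C1' C2' \<pi>1' \<pi>2' m' d' c' e' i' ..
  have link: "groupoid_link C x = (G.\<theta>, G.\<phi>, m)" "groupoid_link C y = (G'.\<theta>, G'.\<phi>, m')"
    by (simp_all add: x y G.\<theta>_def G.\<phi>_def G'.\<theta>_def G'.\<phi>_def)
  show ?thesis
  proof (rule bij_betw_byWitness[where f' = "\<lambda>(f, g). (d' \<cdot> (g \<cdot> e), g, f)"])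
    show "\<forall>h \<in> groupoid_homs C x y.
        (\<lambda>(f, g). (d' \<cdot> (g \<cdot> e), g, f)) ((\<lambda>(f0, f1, f2). (f2, f1)) h) = h"
    proof
      fix h assume "h \<in> groupoid_homs C x y"
      then obtain f0 f1 f2 where h: "h = (f0, f1, f2)"
        and hom: "f0 \<in> Hom C C0 C0'" "f1 \<in> Hom C C1 C1'" and "d' \<cdot> f1 = f0 \<cdot> d"
        by (auto simp: x y)
      then have "d' \<cdot> (f1 \<cdot> e) = f0 \<cdot> (d \<cdot> e)"
        by (intro comp_eq_comp) (simp_all add: hom_iff)
      then show "(\<lambda>(f, g). (d' \<cdot> (g \<cdot> e), g, f)) ((\<lambda>(f0, f1, f2). (f2, f1)) h) = h"
        using hom by (simp add: h hom_iff)
    qed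
    show "(\<lambda>(f0, f1, f2). (f2, f1)) ` groupoid_homs C x y \<subseteq>
        link_homs C (groupoid_link C x) (groupoid_link C y)"
      unfolding link by (auto simp: x y link_hom_if_groupoid_hom)
    show "(\<lambda>(f, g). (d' \<cdot> (g \<cdot> e), g, f)) ` link_homs C (groupoid_link C x) (groupoid_link C y)
        \<subseteq> groupoid_homs C x y"
    proof clarify
      fix f g assume "(f, g) \<in> link_homs C (groupoid_link C x) (groupoid_link C y)"
      then have fg: "f \<in> Hom C C2 C2'" "g \<in> Hom C C1 C1'"
        "f \<cdot> G.\<theta> = G'.\<theta> \<cdot> f" "f \<cdot> G.\<phi> = G'.\<phi> \<cdot> f" "m' \<cdot> f = g \<cdot> m"
        unfolding link by simp_all
      have "d' \<cdot> (g \<cdot> e) \<in> Hom C C0 C0'"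
        using fg(2) by (simp add: hom_iff)
      with fg preserves_projections[OF fg] preserves_inverse[OF fg] preserves_boundary[OF fg]
      show "(d' \<cdot> (g \<cdot> e), g, f) \<in> groupoid_homs C x y"
        unfolding x y groupoid_homs.simps mem_Collect_eq prod.case by (intro conjI)
    qed
  qed auto
qed

lemma groupoid_link_in:
  assumes "x \<in> internal_groupoids C"
  shows "groupoid_link C x \<in> involutive_2_links C"
    "unital C (groupoid_link C x)" "associative C (groupoid_link C x)"
proof -
  obtain C0 C1 C2 \<pi>1 \<pi>2 m d c e i where x: "x = (C0, C1, C2, \<pi>1, \<pi>2, m, d, c, e, i)"
    by (metis prod.exhaust)
  then have G: "internal_groupoid C C0 C1 C2 \<pi>1 \<pi>2 m d c e i"
    using assms by (simp add: internal_groupoids_def)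
  interpret G: groupoid_laws C C0 C1 C2 \<pi>1 \<pi>2 m d c e i
    using G by (rule internal_groupoid_laws)
  obtain q1 q2 where "pullback_square C q1 q2 (d \<cdot> \<pi>2) c"
    using internal_groupoid.associativity[OF G] by blast
  moreover have "groupoid_link C x = (G.\<theta>, G.\<phi>, m)"
    by (simp add: x G.\<theta>_def G.\<phi>_def)
  ultimately show "groupoid_link C x \<in> involutive_2_links C"
    "unital C (groupoid_link C x)" "associative C (groupoid_link C x)"
    using G.link_is_involutive G.link_is_unital G.link_is_associative by simp_all
qed

text \<open>Every condition on morphisms, of groupoids and of links, is a commuting square, so this
  one pasting gives closure under composition in both categories.\<close>

lemma paste_squares:
  assumes "a' \<cdot> f = f' \<cdot> a" "a'' \<cdot> g = g' \<cdot> a'"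
    and "f \<in> Hom C A A'" "g \<in> Hom C A' A''" "f' \<in> Hom C B B'" "g' \<in> Hom C B' B''"
    and "a \<in> Hom C A B" "a' \<in> Hom C A' B'" "a'' \<in> Hom C A'' B''"
  shows "a'' \<cdot> (g \<cdot> f) = (g' \<cdot> f') \<cdot> a"
  using assms comp_eq_comp[OF assms(2), of f] by (simp add: hom_iff)

lemma internal_groupoid_typing:
  assumes "(C0, C1, C2, \<pi>1, \<pi>2, m, d, c, e, i) \<in> internal_groupoids C"
  shows "C0 \<in> Obj C" "C1 \<in> Obj C" "C2 \<in> Obj C"
    "\<pi>1 \<in> Hom C C2 C1" "\<pi>2 \<in> Hom C C2 C1" "m \<in> Hom C C2 C1"
    "d \<in> Hom C C1 C0" "c \<in> Hom C C1 C0" "e \<in> Hom C C0 C1" "i \<in> Hom C C1 C1"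
proof -
  interpret internal_groupoid C C0 C1 C2 \<pi>1 \<pi>2 m d c e i
    using assms by (simp add: internal_groupoids_def)
  show "C0 \<in> Obj C" "C1 \<in> Obj C" "C2 \<in> Obj C"
    "\<pi>1 \<in> Hom C C2 C1" "\<pi>2 \<in> Hom C C2 C1" "m \<in> Hom C C2 C1"
    "d \<in> Hom C C1 C0" "c \<in> Hom C C1 C0" "e \<in> Hom C C0 C1" "i \<in> Hom C C1 C1"
    by (fact objects arrows)+
qed

lemma category_groupoid_category: "category (groupoid_category C)"
  unfolding groupoid_category_def
proof (rule tagged_category_category, goal_cases)
  case (1 x)
  obtain C0 C1 C2 \<pi>1 \<pi>2 m d c e i where x: "x = (C0, C1, C2, \<pi>1, \<pi>2, m, d, c, e, i)"
    by (metis prod.exhaust)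
  show ?case
    using internal_groupoid_typing[OF 1[unfolded x]] by (simp add: x hom_iff)
next
  case (2 x y z f g)
  obtain C0 C1 C2 \<pi>1 \<pi>2 m d c e i where x: "x = (C0, C1, C2, \<pi>1, \<pi>2, m, d, c, e, i)"
    by (metis prod.exhaust)
  obtain C0' C1' C2' \<pi>1' \<pi>2' m' d' c' e' i'
    where y: "y = (C0', C1', C2', \<pi>1', \<pi>2', m', d', c', e', i')"
    by (metis prod.exhaust)
  obtain C0'' C1'' C2'' \<pi>1'' \<pi>2'' m'' d'' c'' e'' i''
    where z: "z = (C0'', C1'', C2'', \<pi>1'', \<pi>2'', m'', d'', c'', e'', i'')"
    by (metis prod.exhaust)
  obtain f0 f1 f2 g0 g1 g2 where fg: "f = (f0, f1, f2)" "g = (g0, g1, g2)"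
    by (metis prod.exhaust)
  note tx = internal_groupoid_typing[OF 2(1)[unfolded x]]
    and ty = internal_groupoid_typing[OF 2(2)[unfolded y]]
    and tz = internal_groupoid_typing[OF 2(3)[unfolded z]]
  have f: "f0 \<in> Hom C C0 C0'" "f1 \<in> Hom C C1 C1'" "f2 \<in> Hom C C2 C2'"
      "\<pi>1' \<cdot> f2 = f1 \<cdot> \<pi>1" "\<pi>2' \<cdot> f2 = f1 \<cdot> \<pi>2" "m' \<cdot> f2 = f1 \<cdot> m"
      "d' \<cdot> f1 = f0 \<cdot> d" "c' \<cdot> f1 = f0 \<cdot> c" "e' \<cdot> f0 = f1 \<cdot> e" "i' \<cdot> f1 = f1 \<cdot> i"
    and g: "g0 \<in> Hom C C0' C0''" "g1 \<in> Hom C C1' C1''" "g2 \<in> Hom C C2' C2''"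
      "\<pi>1'' \<cdot> g2 = g1 \<cdot> \<pi>1'" "\<pi>2'' \<cdot> g2 = g1 \<cdot> \<pi>2'" "m'' \<cdot> g2 = g1 \<cdot> m'"
      "d'' \<cdot> g1 = g0 \<cdot> d'" "c'' \<cdot> g1 = g0 \<cdot> c'" "e'' \<cdot> g0 = g1 \<cdot> e'" "i'' \<cdot> g1 = g1 \<cdot> i'"
    using 2(4,5) by (simp_all add: x y z fg)
  show ?case
    unfolding x z fg groupoid_homs.simps mem_Collect_eq prod.case
    by (intro conjI comp_hom[OF f(1) g(1)] comp_hom[OF f(2) g(2)] comp_hom[OF f(3) g(3)]
        paste_squares[OF f(4) g(4) f(3) g(3) f(2) g(2) tx(4) ty(4) tz(4)]
        paste_squares[OF f(5) g(5) f(3) g(3) f(2) g(2) tx(5) ty(5) tz(5)]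
        paste_squares[OF f(6) g(6) f(3) g(3) f(2) g(2) tx(6) ty(6) tz(6)]
        paste_squares[OF f(7) g(7) f(2) g(2) f(1) g(1) tx(7) ty(7) tz(7)]
        paste_squares[OF f(8) g(8) f(2) g(2) f(1) g(1) tx(8) ty(8) tz(8)]
        paste_squares[OF f(9) g(9) f(1) g(1) f(2) g(2) tx(9) ty(9) tz(9)]
        paste_squares[OF f(10) g(10) f(2) g(2) f(2) g(2) tx(10) ty(10) tz(10)])
next
  case (3 x y f)
  then show ?case
    by (cases x, cases y) (auto simp: hom_iff)
next
  case (4 x y f)
  then show ?case
    by (cases x, cases y) (auto simp: hom_iff)
next
  case (5 w x y z f g h)
  then show ?case
    by (cases w, cases x, cases y, cases z) (auto simp: hom_iff)
qed

lemma category_link_category: "category (link_category C)"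
  unfolding link_category_def
proof (rule tagged_category_category, goal_cases)
  case (1 x)
  then show ?case
    by (auto simp: involutive_2_links_def hom_iff)
next
  case (2 x y z f g)
  obtain \<theta> \<phi> m \<theta>' \<phi>' m' \<theta>'' \<phi>'' m'' where xyz: "x = (\<theta>, \<phi>, m)" "y = (\<theta>', \<phi>', m')" "z = (\<theta>'', \<phi>'', m'')"
    by (metis prod.exhaust)
  obtain f2 f1 g2 g1 where fg: "f = (f2, f1)" "g = (g2, g1)"
    by (metis prod.exhaust)
  have tx: "\<theta> \<in> Hom C (Dom C m) (Dom C m)" "\<phi> \<in> Hom C (Dom C m) (Dom C m)"
      "m \<in> Hom C (Dom C m) (Cod C m)"
    and ty: "\<theta>' \<in> Hom C (Dom C m') (Dom C m')" "\<phi>' \<in> Hom C (Dom C m') (Dom C m')"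
      "m' \<in> Hom C (Dom C m') (Cod C m')"
    and tz: "\<theta>'' \<in> Hom C (Dom C m'') (Dom C m'')" "\<phi>'' \<in> Hom C (Dom C m'') (Dom C m'')"
      "m'' \<in> Hom C (Dom C m'') (Cod C m'')"
    using 2(1-3) by (auto simp: xyz involutive_2_links_def hom_iff)
  have f: "f2 \<in> Hom C (Dom C m) (Dom C m')" "f1 \<in> Hom C (Cod C m) (Cod C m')"
      "\<theta>' \<cdot> f2 = f2 \<cdot> \<theta>" "\<phi>' \<cdot> f2 = f2 \<cdot> \<phi>" "m' \<cdot> f2 = f1 \<cdot> m"
    and g: "g2 \<in> Hom C (Dom C m') (Dom C m'')" "g1 \<in> Hom C (Cod C m') (Cod C m'')"
      "\<theta>'' \<cdot> g2 = g2 \<cdot> \<theta>'" "\<phi>'' \<cdot> g2 = g2 \<cdot> \<phi>'" "m'' \<cdot> g2 = g1 \<cdot> m'"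
    using 2(4,5) by (simp_all add: xyz fg)
  show ?case
    unfolding xyz fg link_homs.simps mem_Collect_eq prod.case
    by (intro conjI comp_hom[OF f(1) g(1)] comp_hom[OF f(2) g(2)]
        paste_squares[OF f(3) g(3) f(1) g(1) f(1) g(1) tx(1) ty(1) tz(1), symmetric]
        paste_squares[OF f(4) g(4) f(1) g(1) f(1) g(1) tx(2) ty(2) tz(2), symmetric]
        paste_squares[OF f(5) g(5) f(1) g(1) f(2) g(2) tx(3) ty(3) tz(3)])
next
  case (3 x y f)
  then show ?case
    by (cases x, cases y) (auto simp: hom_iff)
next
  case (4 x y f)
  then show ?case
    by (cases x, cases y) (auto simp: hom_iff)
next
  case (5 w x y z f g h)
  then show ?case
    by (cases w, cases x, cases y, cases z) (auto simp: hom_iff)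
qed

lemma Hom_groupoid_category:
  "Hom (groupoid_category C) x y =
    {(x, f, y) | f. x \<in> internal_groupoids C \<and> y \<in> internal_groupoids C \<and> f \<in> groupoid_homs C x y}"
  by (simp add: groupoid_category_def Hom_tagged_category)

lemma Hom_link_subcategory:
  "Hom (full_subcategory (link_category C) S) x y =
    {(x, f, y) | f. x \<in> involutive_2_links C \<inter> S \<and> y \<in> involutive_2_links C \<inter> S \<and>
      f \<in> link_homs C x y}"
  by (auto simp: link_category_def Hom_full_subcategory Hom_tagged_category)

lemma groupoid_link_functor:
  "category_functor (groupoid_category C)
    (full_subcategory (link_category C) {L. unital C L \<and> associative C L})
    (groupoid_link C) (groupoid_link_map C)"
proof -
  interpret A: category "groupoid_category C"
    by (rule category_groupoid_category)
  interpret B: category "full_subcategory (link_category C) {L. unital C L \<and> associative C L}"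
    by (rule category_full_subcategory[OF category_link_category])
  show ?thesis
  proof (unfold_locales, goal_cases)
    case (1 x)
    then show ?case
      by (simp add: groupoid_category_def link_category_def tagged_category_def groupoid_link_in)
  next
    case (2 f x y)
    then obtain h where f: "f = (x, h, y)" and xy: "x \<in> internal_groupoids C" "y \<in> internal_groupoids C"
      and h: "h \<in> groupoid_homs C x y"
      by (auto simp: Hom_groupoid_category)
    obtain f0 f1 f2 where h_eq: "h = (f0, f1, f2)"
      by (metis prod.exhaust)
    have "(f2, f1) \<in> link_homs C (groupoid_link C x) (groupoid_link C y)"
      using bij_betwE[OF groupoid_link_homs[OF xy]] h by (auto simp: h_eq)
    then show ?case
      using xy by (simp add: Hom_link_subcategory f h_eq groupoid_link_in)
  next
    case (3 x)
    obtain C0 C1 C2 \<pi>1 \<pi>2 m d c e i where x: "x = (C0, C1, C2, \<pi>1, \<pi>2, m, d, c, e, i)"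
      by (metis prod.exhaust)
    have "m \<in> Hom C C2 C1"
      using 3 by (intro internal_groupoid_typing)
        (simp add: x groupoid_category_def tagged_category_def)
    then show ?case
      by (simp add: x groupoid_category_def link_category_def tagged_category_def hom_iff)
  next
    case (4 f x y g z)
    then obtain f' g' where "f = (x, f', y)" "g = (y, g', z)"
      by (auto simp: Hom_groupoid_category)
    moreover obtain f0 f1 f2 g0 g1 g2 where "f' = (f0, f1, f2)" "g' = (g0, g1, g2)"
      by (metis prod.exhaust)
    ultimately show ?case
      by (simp add: groupoid_category_def link_category_def tagged_category_def)
  qed
qed

end

theorem theorem1:
  fixes C :: "('o, 'a) cat"
  assumes "category C"
  shows "equivalent_categories (groupoid_category C)
    (full_subcategory (link_category C) {L. unital C L \<and> associative C L})"
proof -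
  interpret category C by fact
  show ?thesis
  proof (rule equivalent_categoriesI[OF groupoid_link_functor])
    fix x y assume "x \<in> Obj (groupoid_category C)" "y \<in> Obj (groupoid_category C)"
    then have xy: "x \<in> internal_groupoids C" "y \<in> internal_groupoids C"
      by (simp_all add: groupoid_category_def tagged_category_def)
    note bij = groupoid_link_homs[OF xy]
    let ?H = "groupoid_homs C x y" and ?L = "link_homs C (groupoid_link C x) (groupoid_link C y)"
    have map: "groupoid_link_map C (x, h, y) =
        (groupoid_link C x, (\<lambda>(f0, f1, f2). (f2, f1)) h, groupoid_link C y)" for h
      by (cases h) simp
    \<comment> \<open>With source and target fixed, tagging is injective, so the bijection of
      untagged hom-sets carries over to arrows of the two categories.\<close>
    have "bij_betw (groupoid_link_map C) ((\<lambda>h. (x, h, y)) ` ?H)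
        ((\<lambda>h. (groupoid_link C x, h, groupoid_link C y)) ` ?L)"
      using bij_betw_imp_inj_on[OF bij]
      by (auto simp: bij_betw_def map image_image inj_on_def
          simp flip: bij_betw_imp_surj_on[OF bij])
    moreover have "Hom (groupoid_category C) x y = (\<lambda>h. (x, h, y)) ` ?H"
      using xy by (auto simp: Hom_groupoid_category)
    moreover have "Hom (full_subcategory (link_category C) {L. unital C L \<and> associative C L})
        (groupoid_link C x) (groupoid_link C y) =
        (\<lambda>h. (groupoid_link C x, h, groupoid_link C y)) ` ?L"
      using xy by (auto simp: Hom_link_subcategory groupoid_link_in)
    ultimately show "bij_betw (groupoid_link_map C) (Hom (groupoid_category C) x y)
        (Hom (full_subcategory (link_category C) {L. unital C L \<and> associative C L})
          (groupoid_link C x) (groupoid_link C y))"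
      by simp
  next
    show "Obj (full_subcategory (link_category C) {L. unital C L \<and> associative C L})
        \<subseteq> groupoid_link C ` Obj (groupoid_category C)"
      using groupoid_link_surjective
      by (auto simp: groupoid_category_def link_category_def tagged_category_def)
  qed
qed

end
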